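(* Suppose $n$ is an even integer with $t_2\leq n<\min\{t_1,t_3\}$, and put $K=k_1+k_2+k_3$. Then: (i) the $\mathfrak{BI}$-module $\mathscr M_n(x_2)$ is isomorphic to $W_1\oplus W_1$, where $W_1=E_{n-t_2}\big(k_3+\tfrac{n+1}{2},\,-K-\tfrac{n+1}{2},\,-k_1-\tfrac{n+1}{2}\big)^{(-1,1)}$; (ii) the $\mathfrak{BI}$-module $\mathscr M_n/\mathscr M_n(x_2)$ is isomorphic to $W_2\oplus W_2$, where $W_2=O_{t_2-1}(k_3,\,-K-n-1,\,-k_1)^{(1,-1)}$. Moreover, if $k_1,k_3\geq0$, then $W_1,W_2$ are irreducible and isomorphic to $E_{n-t_2}\big(k_3+\tfrac{n+1}{2},\,K+\tfrac{n+1}{2},\,k_1+\tfrac{n+1}{2}\big)^{(-1,1)}$ and $O_{t_2-1}(k_3,\,K+n+1,\,k_1)$, respectively.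
   Context: Fix real numbers $k_1,k_2,k_3$. For $i=1,2,3$ let $R_i$ be the operator on functions on $\mathbb R^3$ replacing $x_i$ by $-x_i$, and $T_if=\frac{\partial f}{\partial x_i}+k_i\frac{f-R_if}{x_i}$ (Dunkl operators). Let $\sigma_1=\begin{pmatrix}0&1\\1&0\end{pmatrix}$, $\sigma_2=\begin{pmatrix}0&-\sqrt{-1}\\ \sqrt{-1}&0\end{pmatrix}$, $\sigma_3=\begin{pmatrix}1&0\\0&-1\end{pmatrix}$, and let $e_i$ act on $\mathbb C^2$ by $\sigma_i$. Tensor products are over $\mathbb R$; $\mathbb R[\cdots]_m$ denotes homogeneous polynomials of degree $m$. Let $\mathbf D=e_1\otimes T_1+e_2\otimes T_2+e_3\otimes T_3$ and $\mathscr M_n=\ker(\mathbf D|_{\mathbb C^2\otimes\mathbb R[x_1,x_2,x_3]_n})$. For $i=1,2,3$ set $t_i=-2k_i$ if $2k_i$ is an odd negative integer, and $t_i=\infty$ otherwise. For $i=1,2,3$, $\mathscr M_n(x_i)=\mathscr M_n\cap\bigoplus_{j=t_i}^n\mathbb C^2\otimes(x_i^j\cdot\mathbb R[x_p,x_q]_{n-j})$ where $\{p,q\}=\{1,2,3\}\setminus\{i\}$ (it is $\{0\}$ if $n<t_i$); it is a $\mathfrak{BI}$-submodule of $\mathscr M_n$. $\mathfrak{BI}$ is the unital associative $\mathbb C$-algebra generated by $X,Y,Z$ with relations saying that $\{X,Y\}-Z$, $\{Y,Z\}-X$, $\{Z,X\}-Y$ commute with $X,Y,Z$ ($\{A,B\}=AB+BA$).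 $\mathscr M_n$ is a $\mathfrak{BI}$-module via $X=(\sqrt{-1}\,e_1\otimes(x_3T_2-x_2T_3)+\tfrac12)R_2R_3+k_2R_3+k_3R_2$, $Y=(\sqrt{-1}\,e_2\otimes(x_1T_3-x_3T_1)+\tfrac12)R_1R_3+k_3R_1+k_1R_3$, $Z=(\sqrt{-1}\,e_3\otimes(x_2T_1-x_1T_2)+\tfrac12)R_1R_2+k_1R_2+k_2R_1$, operators composed right to left, $R_i$ acting on the polynomial factor. Twisting: for a $\mathfrak{BI}$-module $V$ and algebra automorphism $\varepsilon$, $V^\varepsilon$ is $V$ with action $x\cdot v=\varepsilon(x)v$. The automorphisms $(1,-1)$ and $(-1,1)$ are $X\mapsto X,Y\mapsto -Y,Z\mapsto -Z$ and $X\mapsto -X,Y\mapsto Y,Z\mapsto -Z$, respectively. For $a,b,c\in\mathbb C$ and an integer $d\geq0$, let $\theta_i=\frac{(-1)^i(2a-d+2i)}{2}$, $\theta^*_i=\frac{(-1)^i(2b-d+2i)}{2}$ ($0\le i\le d$). For odd $d$, $E_d(a,b,c)$ is the $\mathfrak{BI}$-module $\mathbb C^{d+1}$ in which, w.r.t. a basis $v_0,\dots,v_d$, $X$ acts by the lower bidiagonal matrix with diagonal $(\theta_i)$ and subdiagonal entries $1$, $Y$ by the upper bidiagonal matrix with diagonal $(\theta^*_i)$ and superdiagonal $(\varphi_1,\dots,\varphi_d)$ with $\varphi_i=i(d-i+1)$ ($i$ even), $\varphi_i=c^2-\frac{(2a+2b-d+2i-1)^2}{4}$ ($i$ odd), and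 $Z=\{X,Y\}-\big(c^2-a^2-b^2+\frac{(d+1)^2}{4}\big)$. For even $d$, $O_d(a,b,c)$ is defined in the same way but with $\varphi_i=\frac{i(d+1-2i-2a-2b-2c)}{2}$ ($i$ even), $\varphi_i=\frac{(i-d-1)(d+1-2i-2a-2b+2c)}{2}$ ($i$ odd), and $Z=\{X,Y\}-(2ab-c(d+1))$. *)

theory Defs
  imports Complex_Main "Jordan_Normal_Form.Matrix" "HOL-Library.Extended_Nat"
begin

text \<open>A monomial x1^a1 x2^a2 x3^a3 is encoded by its exponent triple (a1,a2,a3).
  An element of C^2 (tensor over R) R[x1,x2,x3] is a finitely supported coefficient
  function from monomials to C^2 = complex * complex.  Homogeneity of degree n
  (which we always impose) forces finite support.\<close>

type_synonym mono = "nat \<times> nat \<times> nat"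
type_synonym vpoly = "mono \<Rightarrow> complex \<times> complex"

definition ex :: "nat \<Rightarrow> mono \<Rightarrow> nat" where
  "ex i a = (case a of (a1, a2, a3) \<Rightarrow> if i = 1 then a1 else if i = 2 then a2 else a3)"

definition incx :: "nat \<Rightarrow> mono \<Rightarrow> mono" where
  "incx i a = (case a of (a1, a2, a3) \<Rightarrow>
     if i = 1 then (Suc a1, a2, a3) else if i = 2 then (a1, Suc a2, a3) else (a1, a2, Suc a3))"

definition decx :: "nat \<Rightarrow> mono \<Rightarrow> mono" where
  "decx i a = (case a of (a1, a2, a3) \<Rightarrow>
     if i = 1 then (a1 - 1, a2, a3) else if i = 2 then (a1, a2 - 1, a3) else (a1, a2, a3 - 1))"

definition degm :: "mono \<Rightarrow> nat" where
  "degm a = (case a of (a1, a2, a3) \<Rightarrow> a1 + a2 + a3)"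

definition cpair_add :: "complex \<times> complex \<Rightarrow> complex \<times> complex \<Rightarrow> complex \<times> complex" where
  "cpair_add u v = (fst u + fst v, snd u + snd v)"

definition cpair_scale :: "complex \<Rightarrow> complex \<times> complex \<Rightarrow> complex \<times> complex" where
  "cpair_scale c u = (c * fst u, c * snd u)"

definition vadd :: "vpoly \<Rightarrow> vpoly \<Rightarrow> vpoly" where
  "vadd f g = (\<lambda>a. cpair_add (f a) (g a))"

definition vscale :: "complex \<Rightarrow> vpoly \<Rightarrow> vpoly" where
  "vscale c f = (\<lambda>a. cpair_scale c (f a))"

definition vsub :: "vpoly \<Rightarrow> vpoly \<Rightarrow> vpoly" where
  "vsub f g = vadd f (vscale (-1) g)"

definition vzero :: vpoly where
  "vzero = (\<lambda>a. (0, 0))"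

definition homog :: "nat \<Rightarrow> vpoly \<Rightarrow> bool" where
  "homog n f \<longleftrightarrow> (\<forall>a. degm a \<noteq> n \<longrightarrow> f a = (0, 0))"

definition refl :: "nat \<Rightarrow> vpoly \<Rightarrow> vpoly" where
  "refl i f = (\<lambda>a. cpair_scale ((-1) ^ ex i a) (f a))"

definition mulx :: "nat \<Rightarrow> vpoly \<Rightarrow> vpoly" where
  "mulx i f = (\<lambda>a. if ex i a = 0 then (0, 0) else f (decx i a))"

definition divx :: "nat \<Rightarrow> vpoly \<Rightarrow> vpoly" where
  \<comment> \<open>division by x_i; exact on polynomials without x_i-free terms, such as f - R_i f\<close>
  "divx i f = (\<lambda>a. f (incx i a))"

definition pdx :: "nat \<Rightarrow> vpoly \<Rightarrow> vpoly" where
  "pdx i f = (\<lambda>a. cpair_scale (of_nat (Suc (ex i a))) (f (incx i a)))"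

definition dunkl :: "(nat \<Rightarrow> real) \<Rightarrow> nat \<Rightarrow> vpoly \<Rightarrow> vpoly" where
  "dunkl k i f = vadd (pdx i f) (vscale (complex_of_real (k i)) (divx i (vsub f (refl i f))))"

definition sigma :: "nat \<Rightarrow> complex \<times> complex \<Rightarrow> complex \<times> complex" where
  "sigma i u = (if i = 1 then (snd u, fst u)
                else if i = 2 then (- \<i> * snd u, \<i> * fst u)
                else (fst u, - snd u))"

definition esig :: "nat \<Rightarrow> vpoly \<Rightarrow> vpoly" where
  "esig i f = (\<lambda>a. sigma i (f a))"

definition dirac :: "(nat \<Rightarrow> real) \<Rightarrow> vpoly \<Rightarrow> vpoly" where
  "dirac k f = vadd (esig 1 (dunkl k 1 f)) (vadd (esig 2 (dunkl k 2 f)) (esig 3 (dunkl k 3 f)))"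

definition Mspace :: "(nat \<Rightarrow> real) \<Rightarrow> nat \<Rightarrow> vpoly set" where
  "Mspace k n = {f. homog n f \<and> dirac k f = vzero}"

definition tval :: "real \<Rightarrow> enat" where
  "tval ki = (if \<exists>m::nat. odd m \<and> 2 * ki = - real m then enat (nat \<lfloor>-2 * ki\<rfloor>) else \<infinity>)"

definition Msub :: "(nat \<Rightarrow> real) \<Rightarrow> nat \<Rightarrow> nat \<Rightarrow> vpoly set" where
  "Msub k n i = {f \<in> Mspace k n. \<forall>a. enat (ex i a) < tval (k i) \<longrightarrow> f a = (0, 0)}"

definition BIgen :: "(nat \<Rightarrow> real) \<Rightarrow> nat \<Rightarrow> nat \<Rightarrow> nat \<Rightarrow> vpoly \<Rightarrow> vpoly" where
  "BIgen k i p q f =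
     (let g = refl p (refl q f) in
      vadd (vadd (vscale \<i> (esig i (vsub (mulx q (dunkl k p g)) (mulx p (dunkl k q g)))))
                 (vscale (1/2) g))
           (vadd (vscale (complex_of_real (k p)) (refl q f))
                 (vscale (complex_of_real (k q)) (refl p f))))"

definition Xop :: "(nat \<Rightarrow> real) \<Rightarrow> vpoly \<Rightarrow> vpoly" where "Xop k = BIgen k 1 2 3"
definition Yop :: "(nat \<Rightarrow> real) \<Rightarrow> vpoly \<Rightarrow> vpoly" where "Yop k = BIgen k 2 3 1"
definition Zop :: "(nat \<Rightarrow> real) \<Rightarrow> vpoly \<Rightarrow> vpoly" where "Zop k = BIgen k 3 1 2"

text \<open>A BI-module structure on C^N is determined by the matrices of X, Y, Z.\<close>

type_synonym birep = "complex mat \<times> complex mat \<times> complex mat"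

definition rX :: "birep \<Rightarrow> complex mat" where "rX r = fst r"
definition rY :: "birep \<Rightarrow> complex mat" where "rY r = fst (snd r)"
definition rZ :: "birep \<Rightarrow> complex mat" where "rZ r = snd (snd r)"
definition rdim :: "birep \<Rightarrow> nat" where "rdim r = dim_row (rX r)"

definition anticomm :: "complex mat \<Rightarrow> complex mat \<Rightarrow> complex mat" where
  "anticomm A B = A * B + B * A"

definition Xmat :: "nat \<Rightarrow> complex \<Rightarrow> complex mat" where
  "Xmat d a = mat (d + 1) (d + 1) (\<lambda>(i, j).
     if i = j then (-1) ^ i * (2 * a - of_nat d + 2 * of_nat i) / 2
     else if i = j + 1 then 1 else 0)"

definition Ymat :: "nat \<Rightarrow> complex \<Rightarrow> (nat \<Rightarrow> complex) \<Rightarrow> complex mat" where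
  "Ymat d b ph = mat (d + 1) (d + 1) (\<lambda>(i, j).
     if i = j then (-1) ^ i * (2 * b - of_nat d + 2 * of_nat i) / 2
     else if j = i + 1 then ph j else 0)"

definition phiE :: "nat \<Rightarrow> complex \<Rightarrow> complex \<Rightarrow> complex \<Rightarrow> nat \<Rightarrow> complex" where
  "phiE d a b c i = (if even i then of_nat i * (of_nat d - of_nat i + 1)
     else c ^ 2 - (2 * a + 2 * b - of_nat d + 2 * of_nat i - 1) ^ 2 / 4)"

definition phiO :: "nat \<Rightarrow> complex \<Rightarrow> complex \<Rightarrow> complex \<Rightarrow> nat \<Rightarrow> complex" where
  "phiO d a b c i = (if even i
     then of_nat i * (of_nat d + 1 - 2 * of_nat i - 2 * a - 2 * b - 2 * c) / 2
     else (of_nat i - of_nat d - 1) * (of_nat d + 1 - 2 * of_nat i - 2 * a - 2 * b + 2 * c) / 2)"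

definition Emod :: "nat \<Rightarrow> complex \<Rightarrow> complex \<Rightarrow> complex \<Rightarrow> birep" where   \<comment> \<open>E_d(a,b,c), d odd\<close>
  "Emod d a b c =
     (let X = Xmat d a; Y = Ymat d b (phiE d a b c) in
      (X, Y, anticomm X Y - (c ^ 2 - a ^ 2 - b ^ 2 + (of_nat d + 1) ^ 2 / 4) \<cdot>\<^sub>m 1\<^sub>m (d + 1)))"

definition Omod :: "nat \<Rightarrow> complex \<Rightarrow> complex \<Rightarrow> complex \<Rightarrow> birep" where   \<comment> \<open>O_d(a,b,c), d even\<close>
  "Omod d a b c =
     (let X = Xmat d a; Y = Ymat d b (phiO d a b c) in
      (X, Y, anticomm X Y - (2 * a * b - c * (of_nat d + 1)) \<cdot>\<^sub>m 1\<^sub>m (d + 1)))"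

definition twist_1m1 :: "birep \<Rightarrow> birep" where
  "twist_1m1 r = (rX r, - rY r, - rZ r)"

definition twist_m11 :: "birep \<Rightarrow> birep" where
  "twist_m11 r = (- rX r, rY r, - rZ r)"

definition dsum :: "birep \<Rightarrow> birep \<Rightarrow> birep" where
  "dsum r s =
     (four_block_mat (rX r) (0\<^sub>m (rdim r) (rdim s)) (0\<^sub>m (rdim s) (rdim r)) (rX s),
      four_block_mat (rY r) (0\<^sub>m (rdim r) (rdim s)) (0\<^sub>m (rdim s) (rdim r)) (rY s),
      four_block_mat (rZ r) (0\<^sub>m (rdim r) (rdim s)) (0\<^sub>m (rdim s) (rdim r)) (rZ s))"

definition rep_iso :: "birep \<Rightarrow> birep \<Rightarrow> bool" where
  "rep_iso r s \<longleftrightarrow> rdim r = rdim s \<and>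
     (\<exists>P \<in> carrier_mat (rdim r) (rdim r). invertible_mat P \<and>
        P * rX r = rX s * P \<and> P * rY r = rY s * P \<and> P * rZ r = rZ s * P)"

definition rep_irreducible :: "birep \<Rightarrow> bool" where
  "rep_irreducible r \<longleftrightarrow> rdim r > 0 \<and>
     (\<forall>U. U \<subseteq> carrier_vec (rdim r) \<and> 0\<^sub>v (rdim r) \<in> U \<and>
          (\<forall>u\<in>U. \<forall>v\<in>U. u + v \<in> U) \<and> (\<forall>c. \<forall>u\<in>U. c \<cdot>\<^sub>v u \<in> U) \<and>
          (\<forall>u\<in>U. rX r *\<^sub>v u \<in> U \<and> rY r *\<^sub>v u \<in> U \<and> rZ r *\<^sub>v u \<in> U)
        \<longrightarrow> U = {0\<^sub>v (rdim r)} \<or> U = carrier_vec (rdim r))"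

definition BI_hom_on :: "(nat \<Rightarrow> real) \<Rightarrow> vpoly set \<Rightarrow> birep \<Rightarrow> (vpoly \<Rightarrow> complex vec) \<Rightarrow> bool" where
  "BI_hom_on k S r \<phi> \<longleftrightarrow>
     (\<forall>u\<in>S. \<forall>v\<in>S. \<phi> (vadd u v) = \<phi> u + \<phi> v) \<and>
     (\<forall>c. \<forall>u\<in>S. \<phi> (vscale c u) = c \<cdot>\<^sub>v \<phi> u) \<and>
     (\<forall>u\<in>S. \<phi> (Xop k u) = rX r *\<^sub>v \<phi> u \<and> \<phi> (Yop k u) = rY r *\<^sub>v \<phi> u \<and>
             \<phi> (Zop k u) = rZ r *\<^sub>v \<phi> u)"

definition BI_iso_sub :: "(nat \<Rightarrow> real) \<Rightarrow> vpoly set \<Rightarrow> birep \<Rightarrow> bool" where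
  "BI_iso_sub k S r \<longleftrightarrow>
     (\<exists>\<phi>. BI_hom_on k S r \<phi> \<and> bij_betw \<phi> S (carrier_vec (rdim r)))"

definition BI_iso_quot :: "(nat \<Rightarrow> real) \<Rightarrow> vpoly set \<Rightarrow> vpoly set \<Rightarrow> birep \<Rightarrow> bool" where
  \<comment> \<open>the quotient module M / S is isomorphic to the matrix module r, expressed via a
      surjective BI-module map M \<rightarrow> r with kernel exactly S (first isomorphism theorem)\<close>
  "BI_iso_quot k M S r \<longleftrightarrow>
     (\<exists>\<phi>. BI_hom_on k M r \<phi> \<and> \<phi> ` M = carrier_vec (rdim r) \<and>
          {u \<in> M. \<phi> u = 0\<^sub>v (rdim r)} = S)"

end

theory Submission
  imports Defs "Jordan_Normal_Form.Determinant"
begin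

text \<open>
  An element of the kernel of the Dirac operator is determined by its restriction to \<open>x\<^sub>3 = 0\<close>, since the equation
  expresses the coefficients of \<open>x\<^sub>3\<^sup>r\<^sup>+\<^sup>1\<close> through those of \<open>x\<^sub>3\<^sup>r\<close>.  On restrictions, \<open>X\<close>, \<open>Y\<close>, \<open>Z\<close> preserve the two
  components of \<open>\<complex>\<^sup>2\<close>, and with respect to the monomials \<open>x\<^sub>1\<^sup>n\<^sup>-\<^sup>j x\<^sub>2\<^sup>j\<close> they are lower bidiagonal, upper bidiagonal and
  tridiagonal.  The entry of \<open>Y\<close> leading from \<open>j = t\<^sub>2\<close> to \<open>j = t\<^sub>2 - 1\<close> vanishes, so the monomials with \<open>j \<ge> t\<^sub>2\<close> span
  the submodule and those with \<open>j < t\<^sub>2\<close> describe the quotient.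

  For irreducibility, every nonzero submodule contains the eigenvector \<open>v\<close> of \<open>Y\<close> for the last eigenvalue.  The
  vectors obtained from \<open>v\<close> by applying \<open>X - \<theta>\<^sub>0\<close>, \<open>X - \<theta>\<^sub>1\<close>, \<open>\<dots>\<close> are triangular with nonzero diagonal, hence a
  basis, and in this basis the module takes the form with parameters \<open>(a, -b, -c)\<close>; this also gives the
  isomorphisms.
\<close>

subsection \<open>Bidiagonal operators and the cubic relation\<close>

text \<open>
  Vectors are sequences indexed by all of \<open>nat\<close>, with no truncation at \<open>d\<close>.  The sequences vanishing up to
  index \<open>d\<close> are stable under \<open>lower_op\<close>, and also under \<open>upper_op\<close> as soon as \<open>\<phi> (d + 1) = 0\<close>, so the
  matrix modules are the quotients by these sequences.
\<close>

definition lower_op :: "(nat \<Rightarrow> complex) \<Rightarrow> (nat \<Rightarrow> complex) \<Rightarrow> nat \<Rightarrow> complex" where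
  "lower_op \<theta> u i = \<theta> i * u i + (if i = 0 then 0 else u (i - 1))"

definition upper_op :: "(nat \<Rightarrow> complex) \<Rightarrow> (nat \<Rightarrow> complex) \<Rightarrow> (nat \<Rightarrow> complex) \<Rightarrow> nat \<Rightarrow> complex" where
  "upper_op \<psi> \<phi> u i = \<psi> i * u i + \<phi> (Suc i) * u (Suc i)"

definition eigseq :: "nat \<Rightarrow> complex \<Rightarrow> nat \<Rightarrow> complex" where
  "eigseq d a i = (-1) ^ i * (2 * a - of_nat d + 2 * of_nat i) / 2"

lemma Xmat_mult_vec: "Xmat d a *\<^sub>v vec (d + 1) u = vec (d + 1) (lower_op (eigseq d a) u)"
proof (rule eq_vecI)
  fix i assume "i < dim_vec (vec (d + 1) (lower_op (eigseq d a) u))"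
  then have i: "i < d + 1" by simp
  have "(Xmat d a *\<^sub>v vec (d + 1) u) $ i = (\<Sum>j = 0..<d+1. Xmat d a $$ (i, j) * u j)"
    using i by (simp add: Xmat_def scalar_prod_def)
  also have "\<dots> = (\<Sum>j = 0..<d+1. (if j = i then eigseq d a i * u i else 0) +
       (if j = i - 1 then (if i = 0 then 0 else u (i - 1)) else 0))"
    by (rule sum.cong) (use i in \<open>auto simp: Xmat_def eigseq_def\<close>)
  also have "\<dots> = lower_op (eigseq d a) u i"
    using i by (simp only: sum.distrib) (auto simp: lower_op_def)
  finally show "(Xmat d a *\<^sub>v vec (d + 1) u) $ i = vec (d + 1) (lower_op (eigseq d a) u) $ i"
    using i by simp
qed (simp add: Xmat_def)

text \<open>Row \<open>d\<close> of \<open>upper_op\<close> also reads \<open>u (d + 1)\<close>,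
  which lies outside the matrix; the assumption removes exactly this term.\<close>

lemma Ymat_mult_vec:
  assumes "ph (d + 1) = 0"
  shows "Ymat d b ph *\<^sub>v vec (d + 1) u = vec (d + 1) (upper_op (eigseq d b) ph u)"
proof (rule eq_vecI)
  fix i assume "i < dim_vec (vec (d + 1) (upper_op (eigseq d b) ph u))"
  then have i: "i < d + 1" by simp
  have "(Ymat d b ph *\<^sub>v vec (d + 1) u) $ i = (\<Sum>j = 0..<d+1. Ymat d b ph $$ (i, j) * u j)"
    using i by (simp add: Ymat_def scalar_prod_def)
  also have "\<dots> = (\<Sum>j = 0..<d+1. (if j = i then eigseq d b i * u i else 0) +
       (if j = Suc i then ph (Suc i) * u (Suc i) else 0))"
    by (rule sum.cong) (use i in \<open>auto simp: Ymat_def eigseq_def\<close>)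
  also have "\<dots> = upper_op (eigseq d b) ph u i"
    using i assms by (cases "i = d"; simp only: sum.distrib) (auto simp: upper_op_def)
  finally show "(Ymat d b ph *\<^sub>v vec (d + 1) u) $ i = vec (d + 1) (upper_op (eigseq d b) ph u) $ i"
    using i by simp
qed (simp add: Ymat_def)

text \<open>
  Eliminating \<open>Z\<close> from \<open>{X,Y} - Z = \<kappa>\<close> and \<open>{Z,X} - Y = \<mu>\<close> gives \<open>X\<^sup>2Y + 2XYX + YX\<^sup>2 = Y + \<mu> + 2\<kappa>X\<close>.  For
  lower bidiagonal \<open>X\<close> and upper bidiagonal \<open>Y\<close> this is the following list of identities between the entries
  (for \<open>i = 0\<close> the last one only makes sense because of \<open>\<phi> 0 = 0\<close>).
\<close>

definition split_relation ::
  "(nat \<Rightarrow> complex) \<Rightarrow> (nat \<Rightarrow> complex) \<Rightarrow> (nat \<Rightarrow> complex) \<Rightarrow> complex \<Rightarrow> complex \<Rightarrow> bool" where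
  "split_relation \<theta> \<psi> \<phi> \<kappa> \<mu> \<longleftrightarrow> \<phi> 0 = 0 \<and>
     (\<forall>i. \<psi> i + 2 * \<psi> (Suc i) + \<psi> (Suc (Suc i)) = 0) \<and>
     (\<forall>i. (\<theta> i + \<theta> (Suc i)) ^ 2 = 1) \<and>
     (\<forall>i. (\<theta> i + \<theta> (Suc i)) * (\<psi> i + \<psi> (Suc i)) + \<phi> i + \<phi> (Suc (Suc i))
        + 2 * (\<theta> i * \<psi> i + \<phi> (Suc i) + \<theta> (Suc i) * \<psi> (Suc i)) = 2 * \<kappa>) \<and>
     (\<forall>i. 4 * \<theta> i ^ 2 * \<psi> i + \<phi> i * (2 * \<theta> i + (if i = 0 then 0 else \<theta> (i - 1) + \<theta> i))
        + \<phi> (Suc i) * (3 * \<theta> i + \<theta> (Suc i)) = \<psi> i + \<mu> + 2 * \<kappa> * \<theta> i)"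

text \<open>Fixing the parity of \<open>i\<close> fixes all signs and leaves polynomial identities.
  Both scalars are even in \<open>b\<close> and in \<open>c\<close>, so \<open>(a, b, c)\<close> and
  \<open>(a, - b, - c)\<close> share them.\<close>

lemma split_relation_E:
  "split_relation (eigseq d a) (eigseq d b) (phiE d a b c)
     (c ^ 2 - a ^ 2 - b ^ 2 + (of_nat d + 1) ^ 2 / 4) (b ^ 2 - a ^ 2 - c ^ 2 + (of_nat d + 1) ^ 2 / 4)"
  unfolding split_relation_def
proof (intro conjI allI)
  fix i
  show "phiE d a b c 0 = 0" by (simp add: phiE_def)
  show "eigseq d b i + 2 * eigseq d b (Suc i) + eigseq d b (Suc (Suc i)) = 0"
    by (cases "even i") (simp_all add: eigseq_def field_simps)
  show "(eigseq d a i + eigseq d a (Suc i)) ^ 2 = 1"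
    by (cases "even i") (simp_all add: eigseq_def field_simps power2_eq_square)
  show "(eigseq d a i + eigseq d a (Suc i)) * (eigseq d b i + eigseq d b (Suc i)) + phiE d a b c i
     + phiE d a b c (Suc (Suc i)) + 2 * (eigseq d a i * eigseq d b i + phiE d a b c (Suc i)
     + eigseq d a (Suc i) * eigseq d b (Suc i)) = 2 * (c ^ 2 - a ^ 2 - b ^ 2 + (of_nat d + 1) ^ 2 / 4)"
    by (cases "even i") (simp_all add: eigseq_def phiE_def field_simps power2_eq_square)
  show "4 * eigseq d a i ^ 2 * eigseq d b i + phiE d a b c i * (2 * eigseq d a i +
          (if i = 0 then 0 else eigseq d a (i - 1) + eigseq d a i))
        + phiE d a b c (Suc i) * (3 * eigseq d a i + eigseq d a (Suc i))
      = eigseq d b i + (b ^ 2 - a ^ 2 - c ^ 2 + (of_nat d + 1) ^ 2 / 4) +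
        2 * (c ^ 2 - a ^ 2 - b ^ 2 + (of_nat d + 1) ^ 2 / 4) * eigseq d a i"
    by (cases i; cases "even i") (simp_all add: eigseq_def phiE_def field_simps power2_eq_square)
qed

text \<open>Here both scalars change sign under \<open>(b, c)\<close> to \<open>(- b, - c)\<close>,
  so a comparison of these parameters has to negate \<open>Y\<close> as well.\<close>

lemma split_relation_O:
  "split_relation (eigseq d a) (eigseq d b) (phiO d a b c)
     (2 * a * b - c * (of_nat d + 1)) (2 * a * c - b * (of_nat d + 1))"
  unfolding split_relation_def
proof (intro conjI allI)
  fix i
  show "phiO d a b c 0 = 0" by (simp add: phiO_def)
  show "eigseq d b i + 2 * eigseq d b (Suc i) + eigseq d b (Suc (Suc i)) = 0"
    by (cases "even i") (simp_all add: eigseq_def field_simps)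
  show "(eigseq d a i + eigseq d a (Suc i)) ^ 2 = 1"
    by (cases "even i") (simp_all add: eigseq_def field_simps power2_eq_square)
  show "(eigseq d a i + eigseq d a (Suc i)) * (eigseq d b i + eigseq d b (Suc i)) + phiO d a b c i
     + phiO d a b c (Suc (Suc i)) + 2 * (eigseq d a i * eigseq d b i + phiO d a b c (Suc i)
     + eigseq d a (Suc i) * eigseq d b (Suc i)) = 2 * (2 * a * b - c * (of_nat d + 1))"
    by (cases "even i") (simp_all add: eigseq_def phiO_def field_simps power2_eq_square)
  show "4 * eigseq d a i ^ 2 * eigseq d b i + phiO d a b c i * (2 * eigseq d a i +
          (if i = 0 then 0 else eigseq d a (i - 1) + eigseq d a i))
        + phiO d a b c (Suc i) * (3 * eigseq d a i + eigseq d a (Suc i))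
      = eigseq d b i + (2 * a * c - b * (of_nat d + 1)) +
        2 * (2 * a * b - c * (of_nat d + 1)) * eigseq d a i"
    by (cases i; cases "even i") (simp_all add: eigseq_def phiO_def field_simps power2_eq_square)
qed

text \<open>Each identity is jointly linear in \<open>\<psi>\<close>, \<open>\<phi>\<close>,
  \<open>\<kappa>\<close>, \<open>\<mu>\<close> or involves \<open>\<theta>\<close> alone.\<close>

lemma split_relation_uminus:
  assumes "split_relation \<theta> \<psi> \<phi> \<kappa> \<mu>"
  shows "split_relation \<theta> (\<lambda>i. - \<psi> i) (\<lambda>i. - \<phi> i) (- \<kappa>) (- \<mu>)"
  using assms unfolding split_relation_def by (auto simp: algebra_simps add_eq_0_iff)

lemma split_relation_operators:
  assumes "split_relation \<theta> \<psi> \<phi> \<kappa> \<mu>"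
  defines "L \<equiv> lower_op \<theta>" and "U \<equiv> upper_op \<psi> \<phi>"
  shows "L (L (U u)) i + 2 * L (U (L u)) i + U (L (L u)) i = U u i + \<mu> * u i + 2 * \<kappa> * L u i"
proof -
  note r = assms(1)[unfolded split_relation_def]
  from r have c1: "\<psi> m + 2 * \<psi> (Suc m) + \<psi> (Suc (Suc m)) = 0" for m by blast
  from r have c2: "(\<theta> m + \<theta> (Suc m)) ^ 2 = 1" for m by blast
  from r have c3: "(\<theta> m + \<theta> (Suc m)) * (\<psi> m + \<psi> (Suc m)) + \<phi> m + \<phi> (Suc (Suc m))
        + 2 * (\<theta> m * \<psi> m + \<phi> (Suc m) + \<theta> (Suc m) * \<psi> (Suc m)) = 2 * \<kappa>" for m by blast
  from r have c4: "4 * \<theta> m ^ 2 * \<psi> m + \<phi> m * (2 * \<theta> m + (if m = 0 then 0 else \<theta> (m - 1) + \<theta> m))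
        + \<phi> (Suc m) * (3 * \<theta> m + \<theta> (Suc m)) = \<psi> m + \<mu> + 2 * \<kappa> * \<theta> m" for m by blast
  from r have p0: "\<phi> 0 = 0" by blast
  \<comment> \<open>Words with two factors \<open>L\<close> and one \<open>U\<close> reach only
    \<open>u (i + 1)\<close>, \<open>u i\<close>, \<open>u (i - 1)\<close>,
    \<open>u (i - 2)\<close>. Their coefficients vanish by \<open>c2\<close>, \<open>c4\<close>,
    \<open>c3\<close>, \<open>c1\<close>, in this order; the case distinctions cut off negative
    indices.\<close>
  have "L (L (U u)) i + 2 * L (U (L u)) i + U (L (L u)) i - (U u i + \<mu> * u i + 2 * \<kappa> * L u i)
      = \<phi> (Suc i) * ((\<theta> i + \<theta> (Suc i)) ^ 2 - 1) * u (Suc i)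
      + (4 * \<theta> i ^ 2 * \<psi> i + \<phi> i * (2 * \<theta> i + (if i = 0 then 0 else \<theta> (i - 1) + \<theta> i))
        + \<phi> (Suc i) * (3 * \<theta> i + \<theta> (Suc i)) - (\<psi> i + \<mu> + 2 * \<kappa> * \<theta> i)) * u i
      + (if i = 0 then 0 else ((\<theta> (i-1) + \<theta> i) * (\<psi> (i-1) + \<psi> i) + \<phi> (i-1) + \<phi> (Suc i)
        + 2 * (\<theta> (i-1) * \<psi> (i-1) + \<phi> i + \<theta> i * \<psi> i) - 2 * \<kappa>) * u (i-1))
      + (if i < 2 then 0 else (\<psi> (i-2) + 2 * \<psi> (i-1) + \<psi> i) * u (i-2))"
  proof (cases i)
    case 0
    then show ?thesis
      by (simp add: L_def U_def lower_op_def upper_op_def p0 algebra_simps power2_eq_square)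
  next
    case (Suc j)
    then show ?thesis
      by (cases j) (simp_all add: L_def U_def lower_op_def upper_op_def p0 algebra_simps power2_eq_square)
  qed
  also have "\<dots> = 0"
    using c1[of "i - 2"] c2[of i] c3[of "i - 1"] c4[of i]
    by (cases i; cases "i - 1") (simp_all add: numeral_2_eq_2)
  finally show ?thesis by simp
qed

text \<open>
  Two modules with the same \<open>X\<close> and the same scalars \<open>\<kappa>\<close>, \<open>\<mu>\<close>, the second listing the eigenvalues of \<open>Y\<close> in
  the opposite order.  The assumption \<open>first_step\<close> says that \<open>Y\<close> maps \<open>V 1\<close> (defined below) to
  \<open>\<psi>' 1 * V 1 + \<phi>' 1 * V 0\<close>; the corresponding fact for every other \<open>V j\<close> then follows from the cubic relation.
\<close>

locale split_pair =
  fixes d :: nat and \<theta> \<psi> \<phi> \<psi>' \<phi>' :: "nat \<Rightarrow> complex" and \<kappa> \<mu> :: complex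
  assumes rel: "split_relation \<theta> \<psi> \<phi> \<kappa> \<mu>"
    and rel': "split_relation \<theta> \<psi>' \<phi>' \<kappa> \<mu>"
    and phi_end: "\<phi> (Suc d) = 0"
    and psi_rev: "\<psi>' 0 = \<psi> d"
    and psi_sep: "i < d \<Longrightarrow> \<psi> i \<noteq> \<psi> d"
    and phi_nonzero: "i < d \<Longrightarrow> \<phi> (Suc i) \<noteq> 0"
    and phi'_nonzero: "i < d \<Longrightarrow> \<phi>' (Suc i) \<noteq> 0"
    and first_step: "i \<le> d \<Longrightarrow>
      (\<psi> i - \<psi>' 1) * \<theta> i + (if i = 0 then 0 else (\<psi> i - \<psi>' 1) * \<phi> i / (\<psi> d - \<psi> (i - 1)))
        + \<theta> (Suc i) * (\<psi> d - \<psi> i) + \<phi> (Suc i) = \<theta> 0 * (\<psi> d - \<psi>' 1) + \<phi>' 1"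
begin

text \<open>Eigenvector of \<open>Y\<close> for the last eigenvalue \<open>\<psi> d\<close>,
  obtained by solving the bidiagonal system downwards from the value 1 at index
  \<open>d\<close>.\<close>

definition eigvec :: "nat \<Rightarrow> complex" where
  "eigvec i = (if i \<le> d then \<Prod>l = i..<d. \<phi> (Suc l) / (\<psi> d - \<psi> l) else 0)"

primrec V :: "nat \<Rightarrow> nat \<Rightarrow> complex" where
  "V 0 = eigvec"
| "V (Suc j) = (\<lambda>i. lower_op \<theta> (V j) i - \<theta> j * V j i)"

lemma eigvec_Suc: "i < d \<Longrightarrow> eigvec i * (\<psi> d - \<psi> i) = \<phi> (Suc i) * eigvec (Suc i)"
  using psi_sep[of i] by (simp add: eigvec_def prod.atLeast_Suc_lessThan)

lemma eigvec_last: "eigvec d = 1"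
  by (simp add: eigvec_def)

lemma eigvec_0_nonzero: "eigvec 0 \<noteq> 0"
  using psi_sep phi_nonzero by (force simp: eigvec_def)

lemma upper_eigvec: "i \<le> d \<Longrightarrow> upper_op \<psi> \<phi> eigvec i = \<psi> d * eigvec i"
  using eigvec_Suc[of i] phi_end by (cases "i = d") (auto simp: upper_op_def algebra_simps)

lemma lower_V: "lower_op \<theta> (V j) i = V (Suc j) i + \<theta> j * V j i"
  by simp

text \<open>Subtracting \<open>\<theta> j\<close> removes the leading coordinate of
  \<open>V j\<close>, and the shift in \<open>lower_op\<close> only moves the others to higher
  indices.\<close>

lemma V_support: "i < j \<Longrightarrow> V j i = 0"
proof (induction j arbitrary: i)
  case (Suc j)
  then show ?case
    by (cases "i = j"; cases i) (auto simp: lower_op_def)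
qed simp

lemma lower_cong:
  "(\<And>i. i \<le> d \<Longrightarrow> u i = v i) \<Longrightarrow> i \<le> d \<Longrightarrow> lower_op \<theta> u i = lower_op \<theta> v i"
  by (auto simp: lower_op_def)

lemma lower_lincomb: "lower_op \<theta> (\<lambda>i. a * u i + b * v i) i = a * lower_op \<theta> u i + b * lower_op \<theta> v i"
  by (auto simp: lower_op_def algebra_simps)

lemma upper_lincomb:
  "upper_op \<psi> \<phi> (\<lambda>i. a * u i + b * v i) i = a * upper_op \<psi> \<phi> u i + b * upper_op \<psi> \<phi> v i"
  by (auto simp: upper_op_def algebra_simps)

text \<open>This is \<open>first_step\<close> multiplied by \<open>eigvec i\<close>: the recurrence
  of the eigenvector turns its neighbours into multiples of \<open>eigvec i\<close>, which is where
  the quotient in \<open>first_step\<close> comes from.\<close>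

lemma upper_V_1:
  assumes i: "i \<le> d"
  shows "upper_op \<psi> \<phi> (V 1) i = \<psi>' 1 * V 1 i + \<phi>' 1 * V 0 i"
proof -
  have prev: "\<phi> i / (\<psi> d - \<psi> (i - 1)) * eigvec i = eigvec (i - 1)" if "i \<noteq> 0"
  proof -
    have "i - 1 < d" "Suc (i - 1) = i" using i that by auto
    then show ?thesis using eigvec_Suc[of "i - 1"] psi_sep[of "i - 1"] by (simp add: divide_simps mult.commute)
  qed
  define T where "T = (if i = 0 then 0 else (\<psi> i - \<psi>' 1) * \<phi> i / (\<psi> d - \<psi> (i - 1)))"
  have T: "T * eigvec i = (\<psi> i - \<psi>' 1) * (if i = 0 then 0 else eigvec (i - 1))"
    using prev by (simp add: T_def mult.assoc flip: times_divide_eq_right)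
  have nxt: "\<phi> (Suc i) * eigvec (Suc i) = eigvec i * (\<psi> d - \<psi> i)"
    using eigvec_Suc[of i] i phi_end by (cases "i = d") (auto simp: eigvec_def)
  have "upper_op \<psi> \<phi> (V 1) i - (\<psi>' 1 * V 1 i + \<phi>' 1 * V 0 i)
    = (\<psi> i - \<psi>' 1) * \<theta> i * eigvec i + (\<psi> i - \<psi>' 1) * (if i = 0 then 0 else eigvec (i - 1))
      + \<theta> (Suc i) * (\<phi> (Suc i) * eigvec (Suc i)) + \<phi> (Suc i) * eigvec i
      - \<theta> 0 * (\<psi> i * eigvec i + \<phi> (Suc i) * eigvec (Suc i)) + \<theta> 0 * \<psi>' 1 * eigvec i - \<phi>' 1 * eigvec i"
    by (simp add: upper_op_def lower_op_def algebra_simps)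
  also have "\<dots> = ((\<psi> i - \<psi>' 1) * \<theta> i + T + \<theta> (Suc i) * (\<psi> d - \<psi> i) + \<phi> (Suc i)
      - (\<theta> 0 * (\<psi> d - \<psi>' 1) + \<phi>' 1)) * eigvec i"
    using T unfolding nxt by (simp add: algebra_simps)
  also have "\<dots> = 0" using first_step[OF i] by (simp add: T_def)
  finally show ?thesis by simp
qed

text \<open>The cubic relation applied to \<open>V m\<close> expresses \<open>Y X X V m\<close>,
  hence \<open>Y\<close> on \<open>V (m + 2)\<close>, through \<open>Y V m\<close> and
  \<open>Y X V m\<close>, which are known by induction. The identities of \<open>rel'\<close>,
  having the same \<open>\<kappa>\<close> and \<open>\<mu>\<close>, evaluate the result.\<close>

lemma upper_V: "i \<le> d \<Longrightarrow> upper_op \<psi> \<phi> (V j) i = \<psi>' j * V j i + \<phi>' j * V (j - 1) i"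
proof (induction j arbitrary: i rule: less_induct)
  case (less j)
  let ?L = "lower_op \<theta>" and ?U = "upper_op \<psi> \<phi>"
  note r = rel'[unfolded split_relation_def]
  from r have phi'_0: "\<phi>' 0 = 0" by blast
  consider "j = 0" | "j = 1" | m where "j = Suc (Suc m)"
    by (metis One_nat_def not0_implies_Suc)
  then show ?case
  proof cases
    case 1
    then show ?thesis using upper_eigvec less.prems by (simp add: phi'_0 psi_rev)
  next
    case 2
    then show ?thesis using upper_V_1[OF less.prems] by simp
  next
    case (3 m)
    let ?a = "V (Suc (Suc m))" and ?b = "V (Suc m)" and ?c = "V m" and ?e = "V (m - 1)"
    let ?t = "\<theta> (m - 1)"
    have Uc: "?U ?c i = \<psi>' m * ?c i + \<phi>' m * ?e i" if "i \<le> d" for i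
      using less.IH[of m i] that 3 by simp
    have Ub: "?U ?b i = \<psi>' (Suc m) * ?b i + \<phi>' (Suc m) * ?c i" if "i \<le> d" for i
      using less.IH[of "Suc m" i] that 3 by simp
    \<comment> \<open>The factor \<open>\<phi>' m\<close> covers \<open>m = 0\<close>, where
      \<open>m - 1\<close> is truncated to 0 and the equation without the factor need not
      hold.\<close>
    have Le: "\<phi>' m * ?L ?e i = \<phi>' m * (?c i + ?t * ?e i)" for i
      using lower_V[of "m - 1" i] by (cases m) (simp_all add: phi'_0)
    have Le2: "\<phi>' m * ?t * ?L ?e i = \<phi>' m * ?t * (?c i + ?t * ?e i)"
      and Le3: "\<theta> m * \<phi>' m * ?L ?e i = \<theta> m * \<phi>' m * (?c i + ?t * ?e i)" for i
      using arg_cong[OF Le[of i], of "\<lambda>z. ?t * z"] arg_cong[OF Le[of i], of "\<lambda>z. \<theta> m * z"]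
      by (simp_all only: mult_ac)
    \<comment> \<open>The factor \<open>1\<close> gives the right-hand side the shape that
      \<open>lower_lincomb\<close> matches.\<close>
    have LUc: "?L (?U ?c) i = \<psi>' m * ?b i + 1 * ((\<psi>' m * \<theta> m + \<phi>' m) * ?c i + \<phi>' m * ?t * ?e i)"
      if "i \<le> d" for i
    proof -
      have "?L (?U ?c) i = ?L (\<lambda>i. \<psi>' m * ?c i + \<phi>' m * ?e i) i"
        using Uc that by (rule lower_cong)
      also have "\<dots> = \<psi>' m * ?L ?c i + \<phi>' m * (?c i + ?t * ?e i)"
        by (simp only: lower_lincomb Le)
      finally show ?thesis unfolding lower_V by (simp add: algebra_simps del: V.simps)
    qed
    have LLUc: "?L (?L (?U ?c)) i = \<psi>' m * (?a i + \<theta> (Suc m) * ?b i)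
        + ((\<psi>' m * \<theta> m + \<phi>' m) * (?b i + \<theta> m * ?c i) + \<phi>' m * ?t * (?c i + ?t * ?e i))"
      if "i \<le> d" for i
    proof -
      have "?L (?L (?U ?c)) i = ?L (\<lambda>i. \<psi>' m * ?b i
          + 1 * ((\<psi>' m * \<theta> m + \<phi>' m) * ?c i + \<phi>' m * ?t * ?e i)) i"
        using LUc that by (rule lower_cong)
      also have "\<dots> = \<psi>' m * ?L ?b i + ((\<psi>' m * \<theta> m + \<phi>' m) * ?L ?c i
          + \<phi>' m * ?t * (?c i + ?t * ?e i))"
        by (simp only: lower_lincomb Le2) (simp only: mult_1)
      finally show ?thesis unfolding lower_V .
    qed
    have Lc: "?L ?c = (\<lambda>i. 1 * ?b i + \<theta> m * ?c i)"
      using lower_V[of m] by (simp add: fun_eq_iff)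
    have LLc: "?L (?L ?c) = (\<lambda>i. 1 * ?a i + 1 * ((\<theta> m + \<theta> (Suc m)) * ?b i + \<theta> m ^ 2 * ?c i))"
    proof
      fix i
      have "?L (?L ?c) i = ?L (\<lambda>i. 1 * ?b i + \<theta> m * ?c i) i"
        by (rule arg_cong[OF Lc, of "\<lambda>f. ?L f i"])
      also have "\<dots> = 1 * ?L ?b i + \<theta> m * ?L ?c i"
        by (rule lower_lincomb)
      finally show "?L (?L ?c) i = 1 * ?a i + 1 * ((\<theta> m + \<theta> (Suc m)) * ?b i + \<theta> m ^ 2 * ?c i)"
        unfolding lower_V by (simp add: algebra_simps power2_eq_square del: V.simps)
    qed
    have ULc: "?U (?L ?c) i = \<psi>' (Suc m) * ?b i
        + 1 * ((\<phi>' (Suc m) + \<theta> m * \<psi>' m) * ?c i + \<theta> m * \<phi>' m * ?e i)"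
      if "i \<le> d" for i
      unfolding Lc upper_lincomb using Ub[OF that] Uc[OF that] by (simp add: algebra_simps)
    have LULc: "?L (?U (?L ?c)) i = \<psi>' (Suc m) * (?a i + \<theta> (Suc m) * ?b i)
        + ((\<phi>' (Suc m) + \<theta> m * \<psi>' m) * (?b i + \<theta> m * ?c i) + \<theta> m * \<phi>' m * (?c i + ?t * ?e i))"
      if "i \<le> d" for i
    proof -
      have "?L (?U (?L ?c)) i = ?L (\<lambda>i. \<psi>' (Suc m) * ?b i
          + 1 * ((\<phi>' (Suc m) + \<theta> m * \<psi>' m) * ?c i + \<theta> m * \<phi>' m * ?e i)) i"
        using ULc that by (rule lower_cong)
      also have "\<dots> = \<psi>' (Suc m) * ?L ?b i + ((\<phi>' (Suc m) + \<theta> m * \<psi>' m) * ?L ?c i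
          + \<theta> m * \<phi>' m * (?c i + ?t * ?e i))"
        by (simp only: lower_lincomb Le3) (simp only: mult_1)
      finally show ?thesis unfolding lower_V .
    qed
    have ULLc: "?U (?L (?L ?c)) i = ?U ?a i
        + ((\<theta> m + \<theta> (Suc m)) * (\<psi>' (Suc m) * ?b i + \<phi>' (Suc m) * ?c i)
          + \<theta> m ^ 2 * (\<psi>' m * ?c i + \<phi>' m * ?e i))"
      if "i \<le> d" for i
      unfolding LLc upper_lincomb Ub[OF that] Uc[OF that] by simp
    have i: "i \<le> d" by (fact less.prems)
    have c1: "\<psi>' m + 2 * \<psi>' (Suc m) + \<psi>' (Suc (Suc m)) = 0" using r by blast
    have c2: "\<phi>' m * ((?t + \<theta> m) ^ 2 - 1) = 0"
      using r by (cases m) auto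
    have c3: "(\<theta> m + \<theta> (Suc m)) * (\<psi>' m + \<psi>' (Suc m)) + \<phi>' m + \<phi>' (Suc (Suc m))
        + 2 * (\<theta> m * \<psi>' m + \<phi>' (Suc m) + \<theta> (Suc m) * \<psi>' (Suc m)) = 2 * \<kappa>" using r by blast
    have "4 * \<theta> m ^ 2 * \<psi>' m + \<phi>' m * (2 * \<theta> m + (if m = 0 then 0 else \<theta> (m - 1) + \<theta> m))
        + \<phi>' (Suc m) * (3 * \<theta> m + \<theta> (Suc m)) = \<psi>' m + \<mu> + 2 * \<kappa> * \<theta> m" using r by blast
    then have c4: "4 * \<theta> m ^ 2 * \<psi>' m + \<phi>' m * (3 * \<theta> m + ?t)
        + \<phi>' (Suc m) * (3 * \<theta> m + \<theta> (Suc m)) = \<psi>' m + \<mu> + 2 * \<kappa> * \<theta> m"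
      by (cases m) (simp_all add: phi'_0)
    \<comment> \<open>The unknown \<open>x\<close>, which is \<open>Y\<close> on
      \<open>V (m + 2)\<close>, occurs in the last cubic term \<open>S\<close> with coefficient one,
      so \<open>S - x\<close> is already known.\<close>
    have lin: "x = R - P - 2 * Q - (S - x)" if "P + 2 * Q + S = R" for P Q R S x :: complex
      using that by (simp add: algebra_simps)
    have "?U ?a i = ?U ?c i + \<mu> * ?c i + 2 * \<kappa> * ?L ?c i - ?L (?L (?U ?c)) i - 2 * ?L (?U (?L ?c)) i
        - (?U (?L (?L ?c)) i - ?U ?a i)"
      by (rule lin[OF split_relation_operators[OF rel]])
    \<comment> \<open>The expected value plus multiples of the four identities \<open>c1\<close>,
      \<open>c3\<close>, \<open>c4\<close>, \<open>c2\<close> of the primed data.\<close>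
    also have "\<dots> = \<psi>' (Suc (Suc m)) * ?a i + \<phi>' (Suc (Suc m)) * ?b i
        - (\<psi>' m + 2 * \<psi>' (Suc m) + \<psi>' (Suc (Suc m))) * ?a i
        + (2 * \<kappa> - ((\<theta> m + \<theta> (Suc m)) * (\<psi>' m + \<psi>' (Suc m)) + \<phi>' m + \<phi>' (Suc (Suc m))
        + 2 * (\<theta> m * \<psi>' m + \<phi>' (Suc m) + \<theta> (Suc m) * \<psi>' (Suc m)))) * ?b i
        + (\<psi>' m + \<mu> + 2 * \<kappa> * \<theta> m - (4 * \<theta> m ^ 2 * \<psi>' m + \<phi>' m * (3 * \<theta> m + ?t)
        + \<phi>' (Suc m) * (3 * \<theta> m + \<theta> (Suc m)))) * ?c i
        - \<phi>' m * ((?t + \<theta> m) ^ 2 - 1) * ?e i"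
      unfolding ULLc[OF i] LULc[OF i] LLUc[OF i] Uc[OF i] lower_V
      by (simp add: algebra_simps power2_eq_square del: V.simps)
    also have "\<dots> = \<psi>' j * V j i + \<phi>' j * V (j - 1) i"
      unfolding c1 c2 c3 c4 by (simp add: 3 del: V.simps)
    finally show ?thesis by (simp only: 3)
  qed
qed

text \<open>Coordinate \<open>j\<close> of \<open>upper_V\<close> for \<open>V (Suc j)\<close>
  relates consecutive diagonal entries by the nonzero factors \<open>\<phi> (Suc j)\<close> and
  \<open>\<phi>' (Suc j)\<close>.\<close>

lemma V_diag_nonzero: "j \<le> d \<Longrightarrow> V j j \<noteq> 0"
proof (induction j)
  case 0
  then show ?case using eigvec_0_nonzero by simp
next
  case (Suc j)
  have "\<phi> (Suc j) * V (Suc j) (Suc j) = \<phi>' (Suc j) * V j j"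
    using upper_V[of j "Suc j"] V_support[of j "Suc j"] Suc.prems by (simp add: upper_op_def del: V.simps)
  then show ?case using Suc phi'_nonzero[of j] by auto
qed

end

lemma mat_eq_unit_vecI:
  fixes A B :: "'a :: semiring_1 mat"
  assumes A: "A \<in> carrier_mat m n" and B: "B \<in> carrier_mat m n"
    and eq: "\<And>j. j < n \<Longrightarrow> A *\<^sub>v unit_vec n j = B *\<^sub>v unit_vec n j"
  shows "A = B"
proof (rule eq_matI)
  fix i j assume "i < dim_row B" "j < dim_col B"
  then show "A $$ (i, j) = B $$ (i, j)"
    using arg_cong[OF eq[of j], of "\<lambda>v. v $ i"] A B by simp
qed (use A B in auto)

context split_pair
begin

text \<open>
  Climb with \<open>X\<close> to a vector with nonzero last coordinate, filter out the eigenvector \<open>eigvec\<close> with \<open>Y\<close>, and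
  generate the triangular basis \<open>V\<close> from it with \<open>X\<close>.
\<close>

lemma subspace_full:
  fixes S :: "(nat \<Rightarrow> complex) \<Rightarrow> bool"
  assumes cong: "\<And>u v. S u \<Longrightarrow> (\<And>i. i \<le> d \<Longrightarrow> u i = v i) \<Longrightarrow> S v"
    and lincomb: "\<And>a b u v. S u \<Longrightarrow> S v \<Longrightarrow> S (\<lambda>i. a * u i + b * v i)"
    and lower: "\<And>u. S u \<Longrightarrow> S (lower_op \<theta> u)"
    and upper: "\<And>u. S u \<Longrightarrow> S (upper_op \<psi> \<phi> u)"
    and w: "S w" "i \<le> d" "w i \<noteq> 0"
  shows "S v"
proof -
  \<comment> \<open>The subdiagonal of \<open>X\<close> consists of ones, so each application moves
    the last nonzero coordinate up by one.\<close>
  have top: "\<exists>u. S u \<and> u d \<noteq> 0"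
    if "S u" "m + k = d" "u m \<noteq> 0" "\<And>i. m < i \<Longrightarrow> i \<le> d \<Longrightarrow> u i = 0" for k m u
    using that
  proof (induction k arbitrary: m u)
    case (Suc k)
    show ?case
    proof (rule Suc.IH[of "lower_op \<theta> u" "Suc m"])
      show "S (lower_op \<theta> u)" using Suc.prems lower by blast
      show "lower_op \<theta> u (Suc m) \<noteq> 0" using Suc.prems by (simp add: lower_op_def)
      show "lower_op \<theta> u i = 0" if "Suc m < i" "i \<le> d" for i
        using Suc.prems(4)[of i] Suc.prems(4)[of "i - 1"] that by (simp add: lower_op_def)
    qed (use Suc.prems in simp)
  qed auto
  define m where "m = Max {i. i \<le> d \<and> w i \<noteq> 0}"
  have fin: "finite {i. i \<le> d \<and> w i \<noteq> 0}" by simp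
  have m: "m \<le> d" "w m \<noteq> 0"
    using Max_in[OF fin] w unfolding m_def by blast+
  have "w j = 0" if "m < j" "j \<le> d" for j
    using Max_ge[OF fin, of j] that unfolding m_def by (metis (mono_tags, lifting) leD mem_Collect_eq)
  then obtain u where u: "S u" "u d \<noteq> 0"
    using top[of w m "d - m"] m w(1) by auto
  \<comment> \<open>Downward induction: \<open>(Y - \<psi> l) / (\<psi> d - \<psi> l)\<close> keeps
    the part that already agrees with \<open>eigvec\<close> and replaces coordinate \<open>l\<close>
    by the correct value, whatever it was.\<close>
  have "\<exists>u. S u \<and> (\<forall>i. l \<le> i \<longrightarrow> i \<le> d \<longrightarrow> u i = eigvec i)" if "l \<le> d" for l
    using that
  proof (induction rule: inc_induct)
    case base
    have "S (\<lambda>i. (1 / u d) * u i + 0 * u i)" using u lincomb by blast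
    then show ?case using u eigvec_last by (intro exI[of _ "\<lambda>i. (1 / u d) * u i + 0 * u i"]) auto
  next
    case (step l)
    then obtain u where u: "S u" "\<And>i. Suc l \<le> i \<Longrightarrow> i \<le> d \<Longrightarrow> u i = eigvec i" by blast
    have sep: "\<psi> d - \<psi> l \<noteq> 0" using psi_sep[of l] step by simp
    define v where "v i = (1 / (\<psi> d - \<psi> l)) * upper_op \<psi> \<phi> u i + (- \<psi> l / (\<psi> d - \<psi> l)) * u i" for i
    have v_alt: "v i = (upper_op \<psi> \<phi> u i - \<psi> l * u i) / (\<psi> d - \<psi> l)" for i
      by (simp add: v_def diff_divide_distrib)
    have "S v" unfolding v_def using lincomb u upper by blast
    moreover have "v i = eigvec i" if "l \<le> i" "i \<le> d" for i
    proof (cases "i = l")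
      case True
      have "upper_op \<psi> \<phi> u l = \<psi> l * u l + eigvec l * (\<psi> d - \<psi> l)"
        using u(2)[of "Suc l"] step eigvec_Suc[of l] by (simp add: upper_op_def)
      then show ?thesis using sep True by (simp add: v_alt)
    next
      case False
      then have "upper_op \<psi> \<phi> u i = upper_op \<psi> \<phi> eigvec i"
        using u(2)[of i] u(2)[of "Suc i"] that phi_end by (cases "i = d") (auto simp: upper_op_def)
      then show ?thesis
        using upper_eigvec[of i] u(2)[of i] that False sep by (simp add: v_alt flip: left_diff_distrib)
    qed
    ultimately show ?case by blast
  qed
  from this[of 0] have "S eigvec" using cong by auto
  have V: "S (V j)" for j
  proof (induction j)
    case (Suc j)
    have "S (\<lambda>i. 1 * lower_op \<theta> (V j) i + (- \<theta> j) * V j i)" using Suc lower lincomb by blast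
    then show ?case by simp
  qed (use \<open>S eigvec\<close> in simp)
  \<comment> \<open>Triangular elimination: a multiple of \<open>V l\<close> clears coordinate
    \<open>l\<close>. At \<open>l = Suc d\<close> nothing is left of the relevant
    coordinates.\<close>
  have "S u" if "\<And>i. i < l \<Longrightarrow> u i = 0" "l \<le> Suc d" for l u
    using that(2,1)
  proof (induction arbitrary: u rule: inc_induct)
    case base
    have "S (\<lambda>i. 0 * eigvec i + 0 * eigvec i)" using \<open>S eigvec\<close> lincomb by blast
    then show ?case by (rule cong) (use base in auto)
  next
    case (step l)
    have nz: "V l l \<noteq> 0" using V_diag_nonzero step by simp
    define r where "r i = u i - u l / V l l * V l i" for i
    have "S r"
    proof (rule step.IH)
      show "r i = 0" if "i < Suc l" for i
        using that V_support[of i l] step.prems nz by (cases "i = l") (auto simp: r_def simp del: V.simps)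
    qed
    then have "S (\<lambda>i. 1 * r i + (u l / V l l) * V l i)" using V lincomb by blast
    then show ?case by (simp add: r_def del: V.simps)
  qed
  from this[of 0] show ?thesis by simp
qed

text \<open>The intertwiner goes from the module with data \<open>\<psi>'\<close>,
  \<open>\<phi>'\<close> to the one with \<open>\<psi>\<close>, \<open>\<phi>\<close>, sending the
  standard basis to \<open>V\<close>.\<close>

definition P :: "complex mat" where
  "P = mat (d + 1) (d + 1) (\<lambda>(i, j). V j i)"

lemma P_carrier: "P \<in> carrier_mat (d + 1) (d + 1)"
  by (simp add: P_def)

lemma P_mult_vec: "P *\<^sub>v vec (d + 1) u = vec (d + 1) (\<lambda>i. \<Sum>j = 0..d. u j * V j i)"
  by (rule eq_vecI) (auto simp: P_def scalar_prod_def mult.commute atLeastLessThanSuc_atLeastAtMost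
      simp del: V.simps intro!: sum.cong)

lemma P_unit_vec: "j < d + 1 \<Longrightarrow> P *\<^sub>v unit_vec (d + 1) j = vec (d + 1) (V j)"
  unfolding unit_vec_def P_mult_vec
  by (rule eq_vecI) (simp_all add: if_distrib[of "\<lambda>x. x * _"] del: V.simps cong: if_cong)

lemma P_invertible: "invertible_mat P"
proof -
  have "det P = prod_list (diag_mat P)"
    by (rule det_lower_triangular[OF _ P_carrier]) (simp add: P_def V_support del: V.simps)
  also have "\<dots> \<noteq> 0"
    using V_diag_nonzero by (auto simp: prod_list_zero_iff diag_mat_def P_def simp del: V.simps)
  finally show ?thesis
    using det_non_zero_imp_unit[OF P_carrier, where b = "()"] P_carrier
    by (auto simp: Units_def ring_mat_def invertible_mat_def inverts_mat_def)
qed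

lemma P_intertwines_upper:
  assumes B: "B \<in> carrier_mat (d + 1) (d + 1)" "\<And>u. B *\<^sub>v vec (d + 1) u = vec (d + 1) (upper_op \<psi> \<phi> u)"
    and B': "B' \<in> carrier_mat (d + 1) (d + 1)" "\<And>u. B' *\<^sub>v vec (d + 1) u = vec (d + 1) (upper_op \<psi>' \<phi>' u)"
  shows "P * B' = B * P"
proof (rule mat_eq_unit_vecI)
  fix j assume j: "j < d + 1"
  let ?e = "\<lambda>i. if i = j then 1 else 0 :: complex"
  have phi'_0: "\<phi>' 0 = 0" using rel' by (simp add: split_relation_def)
  have "(P * B') *\<^sub>v unit_vec (d + 1) j = P *\<^sub>v (B' *\<^sub>v unit_vec (d + 1) j)"
    by (rule assoc_mult_mat_vec[OF P_carrier B'(1)]) simp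
  also have "\<dots> = vec (d + 1) (\<lambda>i. \<Sum>l = 0..d. upper_op \<psi>' \<phi>' ?e l * V l i)"
    unfolding unit_vec_def B'(2) P_mult_vec ..
  also have "\<dots> = vec (d + 1) (\<lambda>i. \<psi>' j * V j i + \<phi>' j * V (j - 1) i)"
  proof -
    have "(\<Sum>l = 0..d. upper_op \<psi>' \<phi>' ?e l * V l i)
        = (\<Sum>l = 0..d. (if l = j then \<psi>' j * V j i else 0)
            + (if l = j - 1 then \<phi>' j * V (j - 1) i else 0))" for i
      by (rule sum.cong; cases "j = 0") (auto simp: upper_op_def phi'_0 simp del: V.simps)
    also have "\<dots> i = \<psi>' j * V j i + \<phi>' j * V (j - 1) i" for i
      using j by (cases "j = 0") (simp_all add: sum.distrib phi'_0 del: V.simps)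
    finally show ?thesis by simp
  qed
  also have "\<dots> = vec (d + 1) (upper_op \<psi> \<phi> (V j))"
    by (rule eq_vecI) (simp_all add: upper_V del: V.simps)
  also have "\<dots> = B *\<^sub>v (P *\<^sub>v unit_vec (d + 1) j)"
    unfolding P_unit_vec[OF j] B(2) ..
  also have "\<dots> = (B * P) *\<^sub>v unit_vec (d + 1) j"
    by (rule assoc_mult_mat_vec[OF B(1) P_carrier, symmetric]) simp
  finally show "(P * B') *\<^sub>v unit_vec (d + 1) j = (B * P) *\<^sub>v unit_vec (d + 1) j" .
qed (use P_carrier B B' in auto)

lemma P_intertwines_lower:
  assumes A: "A \<in> carrier_mat (d + 1) (d + 1)" "\<And>u. A *\<^sub>v vec (d + 1) u = vec (d + 1) (lower_op \<theta> u)"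
  shows "P * A = A * P"
proof (rule mat_eq_unit_vecI)
  fix j assume j: "j < d + 1"
  let ?e = "\<lambda>i. if i = j then 1 else 0 :: complex"
  have "(P * A) *\<^sub>v unit_vec (d + 1) j = P *\<^sub>v (A *\<^sub>v unit_vec (d + 1) j)"
    by (rule assoc_mult_mat_vec[OF P_carrier A(1)]) simp
  also have "\<dots> = vec (d + 1) (\<lambda>i. \<Sum>l = 0..d. lower_op \<theta> ?e l * V l i)"
    unfolding unit_vec_def A(2) P_mult_vec ..
  also have "\<dots> = vec (d + 1) (lower_op \<theta> (V j))"
  proof (rule eq_vecI)
    fix i assume "i < dim_vec (vec (d + 1) (lower_op \<theta> (V j)))"
    then have i: "i \<le> d" by simp
    have "(\<Sum>l = 0..d. lower_op \<theta> ?e l * V l i)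
        = (\<Sum>l = 0..d. (if l = j then \<theta> j * V j i else 0) + (if l = Suc j then V (Suc j) i else 0))"
      by (rule sum.cong) (auto simp: lower_op_def simp del: V.simps)
    \<comment> \<open>For \<open>j = d\<close> the sum does not contain the second term, but
      \<open>V (Suc d)\<close> vanishes up to index \<open>d\<close>.\<close>
    also have "\<dots> = \<theta> j * V j i + V (Suc j) i"
      using j V_support[of i "Suc j"] i by (cases "j = d") (simp_all add: sum.distrib del: V.simps)
    finally show "vec (d + 1) (\<lambda>i. \<Sum>l = 0..d. lower_op \<theta> ?e l * V l i) $ i
        = vec (d + 1) (lower_op \<theta> (V j)) $ i"
      using i by simp
  qed simp
  also have "\<dots> = A *\<^sub>v (P *\<^sub>v unit_vec (d + 1) j)"
    unfolding P_unit_vec[OF j] A(2) ..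
  also have "\<dots> = (A * P) *\<^sub>v unit_vec (d + 1) j"
    by (rule assoc_mult_mat_vec[OF A(1) P_carrier, symmetric]) simp
  finally show "(P * A) *\<^sub>v unit_vec (d + 1) j = (A * P) *\<^sub>v unit_vec (d + 1) j" .
qed (use P_carrier A in auto)

end

subsection \<open>Irreducibility and parameter changes\<close>

text \<open>The two values differ by \<open>d - i\<close> up to sign for equal parity of
  \<open>i\<close> and \<open>d\<close>, and by \<open>2 * b + i\<close> up to sign
  otherwise.\<close>

lemma eigseq_separated:
  assumes "i < d" and "2 * b + of_nat i \<noteq> (0 :: complex)"
  shows "eigseq d b i \<noteq> eigseq d b d"
proof
  assume eq: "eigseq d b i = eigseq d b d"
  show False
  proof (cases "even i = even d")
    case True
    then have "(-1 :: complex) ^ i = (-1) ^ d" by (auto simp: minus_one_power_iff)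
    then have "of_nat i = (of_nat d :: complex)" using eq by (simp add: eigseq_def field_simps)
    then show False using assms by simp
  next
    case False
    then have "(-1 :: complex) ^ i = - ((-1) ^ d)" by (auto simp: minus_one_power_iff)
    then have "(-1) ^ d * (2 * b + of_nat i) = eigseq d b d - eigseq d b i"
      by (simp add: eigseq_def field_simps)
    then show False using assms(2) eq by simp
  qed
qed

text \<open>For odd \<open>d\<close>, replacing \<open>b\<close> by \<open>- b\<close> turns the
  first eigenvalue into the former last one.\<close>

lemma split_pair_E:
  assumes "odd d"
    and sep: "\<And>i. i < d \<Longrightarrow> 2 * b + of_nat i \<noteq> 0"
    and nz: "\<And>i. i < d \<Longrightarrow> phiE d a b c (Suc i) \<noteq> 0"
    and nz': "\<And>i. i < d \<Longrightarrow> phiE d a (- b) (- c) (Suc i) \<noteq> 0"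
  shows "split_pair d (eigseq d a) (eigseq d b) (phiE d a b c)
     (eigseq d (- b)) (phiE d a (- b) (- c))
     (c ^ 2 - a ^ 2 - b ^ 2 + (of_nat d + 1) ^ 2 / 4) (b ^ 2 - a ^ 2 - c ^ 2 + (of_nat d + 1) ^ 2 / 4)"
proof
  show "split_relation (eigseq d a) (eigseq d (- b)) (phiE d a (- b) (- c))
     (c ^ 2 - a ^ 2 - b ^ 2 + (of_nat d + 1) ^ 2 / 4) (b ^ 2 - a ^ 2 - c ^ 2 + (of_nat d + 1) ^ 2 / 4)"
    using split_relation_E[of d a "- b" "- c"] by simp
  show "phiE d a b c (Suc d) = 0" "eigseq d (- b) 0 = eigseq d b d"
    using \<open>odd d\<close> by (simp_all add: phiE_def eigseq_def field_simps)
  fix i assume "i \<le> d"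
  \<comment> \<open>The denominator cancels: against the factor \<open>d - i + 1\<close> of
    \<open>phiE\<close> for even \<open>i\<close>, and against the equal eigenvalue difference in
    the numerator for odd \<open>i\<close>.\<close>
  have "(eigseq d b i - eigseq d (- b) 1) * phiE d a b c i / (eigseq d b d - eigseq d b (i - 1))
      = (if even i then of_nat i * (of_nat d - of_nat i - 1) else phiE d a b c i)" if "i \<noteq> 0"
  proof -
    obtain j where j: "i = Suc j" using \<open>i \<noteq> 0\<close> not0_implies_Suc by blast
    show ?thesis
    proof (cases "even i")
      case True
      have "eigseq d b d - eigseq d b (i - 1) = of_nat j - of_nat d"
        and "eigseq d b i - eigseq d (- b) 1 = of_nat j - of_nat d + 2"
        and "phiE d a b c i = of_nat i * (of_nat d - of_nat j)"
        using \<open>odd d\<close> True by (simp_all add: j eigseq_def phiE_def field_simps)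
      moreover have "of_nat j - of_nat d \<noteq> (0 :: complex)"
        using \<open>i \<le> d\<close> j by simp
      ultimately show ?thesis using True by (simp add: j divide_simps) (simp add: algebra_simps)
    next
      case False
      have e: "eigseq d b d - eigseq d b (i - 1) = - (2 * b + of_nat j)"
          "eigseq d b i - eigseq d (- b) 1 = - (2 * b + of_nat j)"
        using \<open>odd d\<close> False by (simp_all add: j eigseq_def field_simps)
      have "- (2 * b + of_nat j) \<noteq> 0" using sep[of j] \<open>i \<le> d\<close> j unfolding neg_equal_0_iff_equal by simp
      then show ?thesis unfolding e using False by (simp only: nonzero_mult_div_cancel_left if_False not_False_eq_True)
    qed
  qed
  note quotient = this
  show "(eigseq d b i - eigseq d (- b) 1) * eigseq d a i
      + (if i = 0 then 0 else (eigseq d b i - eigseq d (- b) 1) * phiE d a b c i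
          / (eigseq d b d - eigseq d b (i - 1)))
      + eigseq d a (Suc i) * (eigseq d b d - eigseq d b i) + phiE d a b c (Suc i)
    = eigseq d a 0 * (eigseq d b d - eigseq d (- b) 1) + phiE d a (- b) (- c) 1"
  proof (cases "i = 0")
    case True
    show ?thesis
      unfolding True if_P[OF refl]
      using \<open>odd d\<close> by (simp add: eigseq_def phiE_def field_simps power2_eq_square)
  next
    case False
    show ?thesis
      unfolding quotient[OF False] if_not_P[OF False]
      using \<open>odd d\<close> by (cases "even i") (simp_all add: eigseq_def phiE_def field_simps power2_eq_square)
  qed
qed (rule split_relation_E, rule eigseq_separated, assumption, erule sep, erule nz, erule nz')

text \<open>For even \<open>d\<close>, the first eigenvalue for \<open>- b\<close> is the negative
  of the former last one, so the primed data carry a minus sign.\<close>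

lemma split_pair_O:
  assumes "even d"
    and sep: "\<And>i. i < d \<Longrightarrow> 2 * b + of_nat i \<noteq> 0"
    and nz: "\<And>i. i < d \<Longrightarrow> phiO d a b c (Suc i) \<noteq> 0"
    and nz': "\<And>i. i < d \<Longrightarrow> phiO d a (- b) (- c) (Suc i) \<noteq> 0"
  shows "split_pair d (eigseq d a) (eigseq d b) (phiO d a b c)
     (\<lambda>i. - eigseq d (- b) i) (\<lambda>i. - phiO d a (- b) (- c) i)
     (2 * a * b - c * (of_nat d + 1)) (2 * a * c - b * (of_nat d + 1))"
proof
  show "split_relation (eigseq d a) (\<lambda>i. - eigseq d (- b) i) (\<lambda>i. - phiO d a (- b) (- c) i)
     (2 * a * b - c * (of_nat d + 1)) (2 * a * c - b * (of_nat d + 1))"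
    using split_relation_uminus[OF split_relation_O[of d a "- b" "- c"]] by simp
  show "phiO d a b c (Suc d) = 0" "- eigseq d (- b) 0 = eigseq d b d"
    using \<open>even d\<close> by (simp_all add: phiO_def eigseq_def field_simps)
  fix i assume "i \<le> d"
  have "(eigseq d b i - - eigseq d (- b) 1) * phiO d a b c i / (eigseq d b d - eigseq d b (i - 1))
      = (if odd i then - (of_nat d - of_nat i - 1) * (of_nat d + 1 - 2 * of_nat i - 2 * a - 2 * b + 2 * c) / 2
         else phiO d a b c i)" if "i \<noteq> 0"
  proof -
    obtain j where j: "i = Suc j" using \<open>i \<noteq> 0\<close> not0_implies_Suc by blast
    show ?thesis
    proof (cases "odd i")
      case True
      have e: "eigseq d b d - eigseq d b (i - 1) = of_nat d - of_nat j"
          "eigseq d b i - - eigseq d (- b) 1 = of_nat d - of_nat i - 1"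
          "phiO d a b c i = - (of_nat d - of_nat j) * (of_nat d + 1 - 2 * of_nat i - 2 * a - 2 * b + 2 * c) / 2"
        using \<open>even d\<close> True by (simp_all add: j eigseq_def phiO_def field_simps)
      have "of_nat d - of_nat j \<noteq> (0 :: complex)"
        using \<open>i \<le> d\<close> j by simp
      moreover have "x * (- D * R / 2) / D = - x * R / 2" if "D \<noteq> 0" for x D R :: complex
        using that by simp
      ultimately show ?thesis unfolding e if_P[OF True] by blast
    next
      case False
      have e: "eigseq d b d - eigseq d b (i - 1) = 2 * b + of_nat j"
          "eigseq d b i - - eigseq d (- b) 1 = 2 * b + of_nat j"
        using \<open>even d\<close> False by (simp_all add: j eigseq_def field_simps)
      have "2 * b + of_nat j \<noteq> 0" using sep[of j] \<open>i \<le> d\<close> j by simp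
      then show ?thesis unfolding e using False by (simp only: nonzero_mult_div_cancel_left if_False not_False_eq_True)
    qed
  qed
  note quotient = this
  show "(eigseq d b i - - eigseq d (- b) 1) * eigseq d a i
      + (if i = 0 then 0 else (eigseq d b i - - eigseq d (- b) 1) * phiO d a b c i
          / (eigseq d b d - eigseq d b (i - 1)))
      + eigseq d a (Suc i) * (eigseq d b d - eigseq d b i) + phiO d a b c (Suc i)
    = eigseq d a 0 * (eigseq d b d - - eigseq d (- b) 1) + - phiO d a (- b) (- c) 1"
  proof (cases "i = 0")
    case True
    show ?thesis
      unfolding True if_P[OF refl]
      using \<open>even d\<close> by (simp add: eigseq_def phiO_def field_simps power2_eq_square)
  next
    case False
    show ?thesis
      unfolding quotient[OF False] if_not_P[OF False]
      using \<open>even d\<close> by (cases "even i") (simp_all add: eigseq_def phiO_def field_simps power2_eq_square)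
  qed
qed (rule split_relation_O, rule eigseq_separated, assumption, erule sep, erule nz, simp add: nz')

text \<open>A subspace stable under \<open>- A\<close> is stable under \<open>A\<close>, so the sign
  twists do not matter, and \<open>subspace_full\<close> applies to vectors read as
  sequences.\<close>

lemma (in split_pair) irreducible_rep:
  assumes A: "A \<in> carrier_mat (d + 1) (d + 1)" "\<And>u. A *\<^sub>v vec (d + 1) u = vec (d + 1) (lower_op \<theta> u)"
    and B: "B \<in> carrier_mat (d + 1) (d + 1)" "\<And>u. B *\<^sub>v vec (d + 1) u = vec (d + 1) (upper_op \<psi> \<phi> u)"
    and r: "rX r = A \<or> rX r = - A" "rY r = B \<or> rY r = - B"
  shows "rep_irreducible r"
  unfolding rep_irreducible_def
proof (intro conjI allI impI)
  have rdim: "rdim r = d + 1" using r A by (auto simp: rdim_def)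
  then show "rdim r > 0" by simp
  fix U :: "complex vec set"
  assume "U \<subseteq> carrier_vec (rdim r) \<and> 0\<^sub>v (rdim r) \<in> U \<and> (\<forall>u\<in>U. \<forall>v\<in>U. u + v \<in> U) \<and>
    (\<forall>c. \<forall>u\<in>U. c \<cdot>\<^sub>v u \<in> U) \<and> (\<forall>u\<in>U. rX r *\<^sub>v u \<in> U \<and> rY r *\<^sub>v u \<in> U \<and> rZ r *\<^sub>v u \<in> U)"
  then have sub: "U \<subseteq> carrier_vec (d + 1)" and zero: "0\<^sub>v (d + 1) \<in> U"
    and add: "\<And>u v. u \<in> U \<Longrightarrow> v \<in> U \<Longrightarrow> u + v \<in> U"
    and smult: "\<And>c u. u \<in> U \<Longrightarrow> c \<cdot>\<^sub>v u \<in> U"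
    and X: "\<And>u. u \<in> U \<Longrightarrow> rX r *\<^sub>v u \<in> U" and Y: "\<And>u. u \<in> U \<Longrightarrow> rY r *\<^sub>v u \<in> U"
    by (auto simp: rdim)
  have neg: "M *\<^sub>v u = (-1) \<cdot>\<^sub>v (- M *\<^sub>v u)"
    if "M \<in> carrier_mat (d + 1) (d + 1)" "u \<in> carrier_vec (d + 1)" for M :: "complex mat" and u
    using that by (intro eq_vecI) auto
  have AU: "A *\<^sub>v u \<in> U" if "u \<in> U" for u
    using r(1) X[OF that] smult[OF X[OF that], of "-1"] neg[OF A(1), of u] sub that by auto
  have BU: "B *\<^sub>v u \<in> U" if "u \<in> U" for u
    using r(2) Y[OF that] smult[OF Y[OF that], of "-1"] neg[OF B(1), of u] sub that by auto
  have vec_U: "vec (d + 1) (($) u) = u" if "u \<in> carrier_vec (d + 1)" for u :: "complex vec"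
    using that by (intro eq_vecI) auto
  have "U = carrier_vec (d + 1)" if ne: "U \<noteq> {0\<^sub>v (d + 1)}"
  proof -
    obtain w where w: "w \<in> U" "w \<noteq> 0\<^sub>v (d + 1)" using ne zero by blast
    have "\<exists>i\<le>d. w $ i \<noteq> 0"
    proof (rule ccontr)
      assume "\<not> ?thesis"
      then have "w = 0\<^sub>v (d + 1)" using w(1) sub by (intro eq_vecI) auto
      then show False using w(2) by simp
    qed
    then obtain i where i: "i \<le> d" "w $ i \<noteq> 0" by blast
    have "vec (d + 1) v \<in> U" for v
    proof (rule subspace_full[of "\<lambda>u. vec (d + 1) u \<in> U" "($) w"])
      show "vec (d + 1) v \<in> U" if "vec (d + 1) u \<in> U" "\<And>i. i \<le> d \<Longrightarrow> u i = v i" for u v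
      proof -
        have "vec (d + 1) u = vec (d + 1) v" using that(2) by (intro eq_vecI) auto
        then show ?thesis using that(1) by simp
      qed
      show "vec (d + 1) (\<lambda>i. a * u i + b * v i) \<in> U"
        if "vec (d + 1) u \<in> U" "vec (d + 1) v \<in> U" for a b u v
      proof -
        have "vec (d + 1) (\<lambda>i. a * u i + b * v i) = a \<cdot>\<^sub>v vec (d + 1) u + b \<cdot>\<^sub>v vec (d + 1) v"
          by (intro eq_vecI) auto
        then show ?thesis using that add smult by simp
      qed
      show "vec (d + 1) (lower_op \<theta> u) \<in> U" if "vec (d + 1) u \<in> U" for u
        using AU[OF that] A(2) by simp
      show "vec (d + 1) (upper_op \<psi> \<phi> u) \<in> U" if "vec (d + 1) u \<in> U" for u
        using BU[OF that] B(2) by simp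
      show "vec (d + 1) (($) w) \<in> U" using w(1) sub vec_U by auto
    qed (use i in auto)
    then have "v \<in> U" if "v \<in> carrier_vec (d + 1)" for v
      using vec_U[OF that] by metis
    then show ?thesis using sub by blast
  qed
  then show "U = {0\<^sub>v (rdim r)} \<or> U = carrier_vec (rdim r)" unfolding rdim by blast
qed

section \<open>Intertwining relations for the matrix of \<open>Z\<close>\<close>

lemma anticomm_carrier:
  "A \<in> carrier_mat n n \<Longrightarrow> B \<in> carrier_mat n n \<Longrightarrow> anticomm A B \<in> carrier_mat n n"
  by (simp add: anticomm_def)

lemma product_intertwines:
  assumes "P \<in> carrier_mat n n" "A \<in> carrier_mat n n" "A' \<in> carrier_mat n n"
    and "B \<in> carrier_mat n n" "B' \<in> carrier_mat n n"
    and PA: "P * A' = A * P" and PB: "P * B' = B * P"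
  shows "P * (A' * B') = (A * B) * P"
proof -
  have "P * (A' * B') = (A * P) * B'" using assms by (simp flip: PA)
  also have "\<dots> = A * (B * P)" using assms by (simp flip: PB)
  finally show ?thesis using assms by simp
qed

lemma anticomm_intertwines:
  assumes P: "P \<in> carrier_mat n n" and A: "A \<in> carrier_mat n n" "A' \<in> carrier_mat n n"
    and B: "B \<in> carrier_mat n n" "B' \<in> carrier_mat n n"
    and PA: "P * A' = A * P" and PB: "P * B' = B * P"
  shows "P * anticomm A' B' = anticomm A B * P"
proof -
  have "P * anticomm A' B' = P * (A' * B') + P * (B' * A')"
    unfolding anticomm_def by (rule mult_add_distrib_mat[of _ n n]) (use A B P in auto)
  also have "\<dots> = (A * B) * P + (B * A) * P"
    using product_intertwines[OF P A B PA PB] product_intertwines[OF P B A PB PA] by simp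
  also have "\<dots> = anticomm A B * P"
    unfolding anticomm_def by (rule add_mult_distrib_mat[of _ n n, symmetric]) (use A B P in auto)
  finally show ?thesis .
qed

lemma shift_intertwines:
  fixes \<kappa> :: "'a :: comm_ring_1"
  assumes P: "P \<in> carrier_mat n n" and C: "C \<in> carrier_mat n n" "C' \<in> carrier_mat n n"
    and PC: "P * C' = C * P"
  shows "P * (C' - \<kappa> \<cdot>\<^sub>m 1\<^sub>m n) = (C - \<kappa> \<cdot>\<^sub>m 1\<^sub>m n) * P"
proof -
  have "P * (C' - \<kappa> \<cdot>\<^sub>m 1\<^sub>m n) = P * C' - P * (\<kappa> \<cdot>\<^sub>m 1\<^sub>m n)"
    by (rule mult_minus_distrib_mat[of _ n n]) (use P C in auto)
  also have "P * (\<kappa> \<cdot>\<^sub>m 1\<^sub>m n) = (\<kappa> \<cdot>\<^sub>m 1\<^sub>m n) * P"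
    using P mult_smult_distrib[of P n n "1\<^sub>m n" n \<kappa>] mult_smult_assoc_mat[of "1\<^sub>m n" n n P n \<kappa>] by simp
  also have "P * C' - (\<kappa> \<cdot>\<^sub>m 1\<^sub>m n) * P = (C - \<kappa> \<cdot>\<^sub>m 1\<^sub>m n) * P"
    unfolding PC by (rule minus_mult_distrib_mat[of _ n n, symmetric]) (use P C in auto)
  finally show ?thesis .
qed

lemma neg_intertwines:
  fixes P :: "'a :: comm_ring_1 mat"
  assumes "P \<in> carrier_mat n n" "C \<in> carrier_mat n n" "C' \<in> carrier_mat n n" "P * C' = C * P"
  shows "P * (- C') = (- C) * P"
  using assms by (metis carrier_matD uminus_mult_left_mat uminus_mult_right_mat)

lemma Xmat_carrier: "Xmat d a \<in> carrier_mat (d + 1) (d + 1)"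
  by (simp add: Xmat_def)

lemma Ymat_carrier: "Ymat d b ph \<in> carrier_mat (d + 1) (d + 1)"
  by (simp add: Ymat_def)

lemma uminus_mat_mult_vec:
  fixes A :: "'a :: comm_ring_1 mat"
  assumes "A \<in> carrier_mat m n" "v \<in> carrier_vec n"
  shows "(- A) *\<^sub>v v = - (A *\<^sub>v v)"
  using assms by (intro eq_vecI) auto

lemma uminus_Ymat_mult_vec:
  assumes "ph (d + 1) = 0"
  shows "(- Ymat d b ph) *\<^sub>v vec (d + 1) u
    = vec (d + 1) (upper_op (\<lambda>i. - eigseq d b i) (\<lambda>i. - ph i) u)"
  unfolding uminus_mat_mult_vec[OF Ymat_carrier vec_carrier] Ymat_mult_vec[of ph, OF assms]
  by (rule eq_vecI) (simp_all add: upper_op_def)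

lemma Ymat_phiE_mult_vec:
  "odd d \<Longrightarrow> Ymat d b (phiE d a b' c) *\<^sub>v vec (d + 1) u
    = vec (d + 1) (upper_op (eigseq d b) (phiE d a b' c) u)"
  by (rule Ymat_mult_vec) (simp add: phiE_def)

lemma Ymat_phiO_mult_vec:
  "even d \<Longrightarrow> Ymat d b (phiO d a b' c) *\<^sub>v vec (d + 1) u
    = vec (d + 1) (upper_op (eigseq d b) (phiO d a b' c) u)"
  by (rule Ymat_mult_vec) (simp add: phiO_def)

lemma uminus_Ymat_phiO_mult_vec:
  "even d \<Longrightarrow> (- Ymat d b (phiO d a b' c)) *\<^sub>v vec (d + 1) u
    = vec (d + 1) (upper_op (\<lambda>i. - eigseq d b i) (\<lambda>i. - phiO d a b' c i) u)"
  by (rule uminus_Ymat_mult_vec) (simp add: phiO_def)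

lemma rep_selectors [simp]: "rX (x, y, z) = x" "rY (x, y, z) = y" "rZ (x, y, z) = z"
  by (simp_all add: rX_def rY_def rZ_def)

lemma Emod_irreducible:
  assumes d: "odd d"
    and sep: "\<And>i. i < d \<Longrightarrow> 2 * b + of_nat i \<noteq> 0"
    and nz: "\<And>i. i < d \<Longrightarrow> phiE d a b c (Suc i) \<noteq> 0"
    and nz': "\<And>i. i < d \<Longrightarrow> phiE d a (- b) (- c) (Suc i) \<noteq> 0"
  shows "rep_irreducible (twist_m11 (Emod d a b c))"
proof -
  interpret split_pair d "eigseq d a" "eigseq d b" "phiE d a b c" "eigseq d (- b)" "phiE d a (- b) (- c)"
    "c ^ 2 - a ^ 2 - b ^ 2 + (of_nat d + 1) ^ 2 / 4" "b ^ 2 - a ^ 2 - c ^ 2 + (of_nat d + 1) ^ 2 / 4"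
    by (rule split_pair_E[OF d sep nz nz'])
  show ?thesis
    by (rule irreducible_rep[OF Xmat_carrier Xmat_mult_vec Ymat_carrier Ymat_phiE_mult_vec[OF d]])
       (simp_all add: twist_m11_def Emod_def Let_def)
qed

text \<open>As \<open>P\<close> leads from the primed to the unprimed module,
  \<open>(a, b, c)\<close> takes the primed role and the eigenvalues for \<open>- b\<close> have to
  be separated. Intertwining \<open>X\<close> and \<open>Y\<close> extends to \<open>Z\<close>
  because both modules have the same scalar.\<close>

lemma Emod_iso:
  assumes d: "odd d"
    and sep: "\<And>i. i < d \<Longrightarrow> - 2 * b + of_nat i \<noteq> 0"
    and nz: "\<And>i. i < d \<Longrightarrow> phiE d a b c (Suc i) \<noteq> 0"
    and nz': "\<And>i. i < d \<Longrightarrow> phiE d a (- b) (- c) (Suc i) \<noteq> 0"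
  shows "rep_iso (twist_m11 (Emod d a b c)) (twist_m11 (Emod d a (- b) (- c)))"
proof -
  let ?X = "Xmat d a" and ?Y' = "Ymat d b (phiE d a b c)" and ?Y = "Ymat d (- b) (phiE d a (- b) (- c))"
  interpret split_pair d "eigseq d a" "eigseq d (- b)" "phiE d a (- b) (- c)"
    "eigseq d (- (- b))" "phiE d a (- (- b)) (- (- c))"
    "(- c) ^ 2 - a ^ 2 - (- b) ^ 2 + (of_nat d + 1) ^ 2 / 4"
    "(- b) ^ 2 - a ^ 2 - (- c) ^ 2 + (of_nat d + 1) ^ 2 / 4"
    by (rule split_pair_E[OF d]) (use sep nz nz' in auto)
  note car = P_carrier Xmat_carrier[of d a] Ymat_carrier[of d b "phiE d a b c"]
    Ymat_carrier[of d "- b" "phiE d a (- b) (- c)"]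
  have X: "P * ?X = ?X * P"
    by (rule P_intertwines_lower[OF Xmat_carrier Xmat_mult_vec])
  have act: "?Y' *\<^sub>v vec (d + 1) u
      = vec (d + 1) (upper_op (eigseq d (- (- b))) (phiE d a (- (- b)) (- (- c))) u)" for u
    unfolding minus_minus by (rule Ymat_phiE_mult_vec[OF d])
  have Y: "P * ?Y' = ?Y * P"
    by (rule P_intertwines_upper[OF Ymat_carrier Ymat_phiE_mult_vec[OF d] Ymat_carrier act])
  have "P * (anticomm ?X ?Y' - \<kappa> \<cdot>\<^sub>m 1\<^sub>m (d + 1)) = (anticomm ?X ?Y - \<kappa> \<cdot>\<^sub>m 1\<^sub>m (d + 1)) * P" for \<kappa>
    by (intro shift_intertwines anticomm_intertwines[of _ "d + 1"] anticomm_carrier car X Y)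
  then have "P * - (anticomm ?X ?Y' - \<kappa> \<cdot>\<^sub>m 1\<^sub>m (d + 1)) = - (anticomm ?X ?Y - \<kappa> \<cdot>\<^sub>m 1\<^sub>m (d + 1)) * P" for \<kappa>
    using car by (intro neg_intertwines[of _ "d + 1"] minus_carrier_mat) auto
  moreover have "P * - ?X = - ?X * P"
    by (rule neg_intertwines[OF _ _ _ X]) (rule car)+
  ultimately show ?thesis
    using P_carrier P_invertible Y
    unfolding rep_iso_def by (intro conjI bexI[of _ P]) (simp_all add: twist_m11_def Emod_def Let_def rdim_def Xmat_def)
qed

lemma Omod_irreducible:
  assumes d: "even d"
    and sep: "\<And>i. i < d \<Longrightarrow> 2 * b + of_nat i \<noteq> 0"
    and nz: "\<And>i. i < d \<Longrightarrow> phiO d a b c (Suc i) \<noteq> 0"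
    and nz': "\<And>i. i < d \<Longrightarrow> phiO d a (- b) (- c) (Suc i) \<noteq> 0"
  shows "rep_irreducible (twist_1m1 (Omod d a b c))"
proof -
  interpret split_pair d "eigseq d a" "eigseq d b" "phiO d a b c"
    "\<lambda>i. - eigseq d (- b) i" "\<lambda>i. - phiO d a (- b) (- c) i"
    "2 * a * b - c * (of_nat d + 1)" "2 * a * c - b * (of_nat d + 1)"
    by (rule split_pair_O[OF d sep nz nz'])
  show ?thesis
    by (rule irreducible_rep[OF Xmat_carrier Xmat_mult_vec Ymat_carrier Ymat_phiO_mult_vec[OF d]])
       (simp_all add: twist_1m1_def Omod_def Let_def)
qed

lemma anticomm_uminus_right:
  fixes A :: "complex mat"
  assumes "A \<in> carrier_mat n n" "B \<in> carrier_mat n n"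
  shows "- (anticomm A B - \<kappa> \<cdot>\<^sub>m 1\<^sub>m n) = anticomm A (- B) - (- \<kappa>) \<cdot>\<^sub>m 1\<^sub>m n"
proof -
  have "A * - B = - (A * B)" "- B * A = - (B * A)"
    using assms by (auto simp: uminus_mult_left_mat uminus_mult_right_mat)
  then show ?thesis
    using assms by (intro eq_matI) (auto simp: anticomm_def)
qed

text \<open>The twist on the source supplies the sign in the primed data of
  \<open>split_pair_O\<close>; hence the target is untwisted.\<close>

lemma Omod_iso:
  assumes d: "even d"
    and sep: "\<And>i. i < d \<Longrightarrow> - 2 * b + of_nat i \<noteq> 0"
    and nz: "\<And>i. i < d \<Longrightarrow> phiO d a b c (Suc i) \<noteq> 0"
    and nz': "\<And>i. i < d \<Longrightarrow> phiO d a (- b) (- c) (Suc i) \<noteq> 0"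
  shows "rep_iso (twist_1m1 (Omod d a b c)) (Omod d a (- b) (- c))"
proof -
  let ?X = "Xmat d a" and ?Y' = "- Ymat d b (phiO d a b c)" and ?Y = "Ymat d (- b) (phiO d a (- b) (- c))"
  let ?\<kappa> = "2 * a * b - c * (of_nat d + 1)"
  interpret split_pair d "eigseq d a" "eigseq d (- b)" "phiO d a (- b) (- c)"
    "\<lambda>i. - eigseq d (- (- b)) i" "\<lambda>i. - phiO d a (- (- b)) (- (- c)) i"
    "2 * a * (- b) - (- c) * (of_nat d + 1)" "2 * a * (- c) - (- b) * (of_nat d + 1)"
    by (rule split_pair_O[OF d]) (use sep nz nz' in auto)
  have Y'_carrier: "?Y' \<in> carrier_mat (d + 1) (d + 1)"
    using Ymat_carrier by simp
  note car = P_carrier Xmat_carrier[of d a] Y'_carrier Ymat_carrier[of d "- b" "phiO d a (- b) (- c)"]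
  have X: "P * ?X = ?X * P"
    by (rule P_intertwines_lower[OF Xmat_carrier Xmat_mult_vec])
  have act: "?Y' *\<^sub>v vec (d + 1) u = vec (d + 1) (upper_op (\<lambda>i. - eigseq d (- (- b)) i)
      (\<lambda>i. - phiO d a (- (- b)) (- (- c)) i) u)" for u
    unfolding minus_minus by (rule uminus_Ymat_phiO_mult_vec[OF d])
  have Y: "P * ?Y' = ?Y * P"
    by (rule P_intertwines_upper[OF Ymat_carrier Ymat_phiO_mult_vec[OF d] Y'_carrier act])
  have "P * (anticomm ?X ?Y' - (- ?\<kappa>) \<cdot>\<^sub>m 1\<^sub>m (d + 1)) = (anticomm ?X ?Y - (- ?\<kappa>) \<cdot>\<^sub>m 1\<^sub>m (d + 1)) * P"
    by (intro shift_intertwines anticomm_intertwines[of _ "d + 1"] anticomm_carrier car X Y)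
  moreover have "- (anticomm ?X (Ymat d b (phiO d a b c)) - ?\<kappa> \<cdot>\<^sub>m 1\<^sub>m (d + 1))
      = anticomm ?X ?Y' - (- ?\<kappa>) \<cdot>\<^sub>m 1\<^sub>m (d + 1)"
    by (rule anticomm_uminus_right[OF Xmat_carrier Ymat_carrier])
  moreover have "2 * a * (- b) - (- c) * (of_nat d + 1) = - ?\<kappa>" by simp
  ultimately have "P * rZ (twist_1m1 (Omod d a b c)) = rZ (Omod d a (- b) (- c)) * P"
    unfolding Omod_def twist_1m1_def Let_def rep_selectors by metis
  then show ?thesis
    using P_carrier P_invertible X Y
    unfolding rep_iso_def by (intro conjI bexI[of _ P]) (simp_all add: twist_1m1_def Omod_def Let_def rdim_def Xmat_def)
qed

subsection \<open>The kernel of the Dirac operator restricted to a plane\<close>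

text \<open>The factor in \<open>T\<^sub>i x\<^sub>i\<^sup>m = (m + k\<^sub>i (1 - (-1)\<^sup>m)) x\<^sub>i\<^sup>m\<^sup>-\<^sup>1\<close>.\<close>

definition dunkl_coeff :: "(nat \<Rightarrow> real) \<Rightarrow> nat \<Rightarrow> nat \<Rightarrow> complex" where
  "dunkl_coeff k i m = of_nat m + (if odd m then 2 * of_real (k i) else 0)"

lemma dunkl_coeff_0 [simp]: "dunkl_coeff k i 0 = 0"
  by (simp add: dunkl_coeff_def)

text \<open>The difference \<open>f - R_i f\<close> kills even powers of \<open>x_i\<close> and
  doubles odd ones.\<close>

lemma dunkl_apply:
  "dunkl k i f a = cpair_scale (dunkl_coeff k i (Suc (ex i a))) (f (incx i a))"
proof -
  have "ex i (incx i a) = Suc (ex i a)"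
    by (simp add: ex_def incx_def split: prod.splits)
  then show ?thesis
    by (cases "even (ex i a)")
       (simp_all add: dunkl_def dunkl_coeff_def vadd_def pdx_def vscale_def divx_def vsub_def refl_def
        cpair_add_def cpair_scale_def algebra_simps)
qed

definition component :: "bool \<Rightarrow> complex \<times> complex \<Rightarrow> complex" where
  "component s u = (if s then fst u else snd u)"

text \<open>Eigenvalue of \<open>sigma 3\<close> on component \<open>s\<close>;
  \<open>sigma 1\<close> and \<open>sigma 2\<close> exchange \<open>s\<close> and
  \<open>\<not> s\<close>.\<close>

definition sg :: "bool \<Rightarrow> complex" where
  "sg s = (if s then 1 else - 1)"

lemma component_linear [simp]:
  "component s (vadd f g a) = component s (f a) + component s (g a)"
  "component s (vscale c f a) = c * component s (f a)"
  "component s (0, 0) = 0"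
  by (simp_all add: component_def vadd_def vscale_def cpair_add_def cpair_scale_def)

lemma pair_eq_component: "u = v \<longleftrightarrow> (\<forall>s. component s u = component s v)"
  by (auto simp: component_def prod_eq_iff split: if_splits)

lemma component_dirac:
  "component s (dirac k f (p, q, r)) = dunkl_coeff k 1 (Suc p) * component (\<not> s) (f (Suc p, q, r))
     - \<i> * sg s * dunkl_coeff k 2 (Suc q) * component (\<not> s) (f (p, Suc q, r))
     + sg s * dunkl_coeff k 3 (Suc r) * component s (f (p, q, Suc r))"
  by (simp add: dirac_def vadd_def esig_def dunkl_apply component_def sg_def sigma_def cpair_add_def
      cpair_scale_def ex_def incx_def)

lemma dirac_zero_step:
  assumes "dirac k f = vzero"
  shows "dunkl_coeff k 3 (Suc r) * component s (f (p, q, Suc r))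
     = - sg s * dunkl_coeff k 1 (Suc p) * component (\<not> s) (f (Suc p, q, r))
       + \<i> * dunkl_coeff k 2 (Suc q) * component (\<not> s) (f (p, Suc q, r))"
proof -
  have "component s (dirac k f (p, q, r)) = 0" using assms by (simp add: vzero_def)
  then show ?thesis by (cases s) (auto simp: component_dirac sg_def algebra_simps add_eq_0_iff)
qed

text \<open>On the plane \<open>x_3 = 0\<close> only \<open>x_2 T_3\<close> survives in the
  differential part, and the Dirac equation replaces \<open>T_3\<close>. Both this and
  \<open>e_1\<close> exchange the components, so together they preserve them.\<close>

lemma component_Xop:
  assumes "dirac k f = vzero"
  shows "component s (Xop k f (p, q, 0))
    = (if q = 0 then 0 else - \<i> * sg s * (-1) ^ q * dunkl_coeff k 1 (Suc p) * component s (f (Suc p, q - 1, 0)))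
      + (-1) ^ q * (of_nat q + 1 / 2 + of_real (k 2) + of_real (k 3)) * component s (f (p, q, 0))"
proof -
  have "component s (Xop k f (p, q, 0)) = (if q = 0 then 0 else
        - \<i> * (-1) ^ q * (dunkl_coeff k 3 (Suc 0) * component (\<not> s) (f (p, q - 1, Suc 0))))
      + ((-1) ^ q * (1 / 2 + of_real (k 3)) + of_real (k 2)) * component s (f (p, q, 0))"
    by (cases q) (simp_all add: Xop_def BIgen_def Let_def vadd_def vsub_def esig_def mulx_def refl_def
        vscale_def dunkl_apply component_def sigma_def cpair_add_def cpair_scale_def ex_def incx_def decx_def
        algebra_simps)
  also have "\<dots> = (if q = 0 then 0 else - \<i> * sg s * (-1) ^ q * dunkl_coeff k 1 (Suc p) * component s (f (Suc p, q - 1, 0)))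
      + ((-1) ^ q * (dunkl_coeff k 2 q + 1 / 2 + of_real (k 3)) + of_real (k 2)) * component s (f (p, q, 0))"
    unfolding dirac_zero_step[OF assms]
    by (cases q; cases s) (simp_all add: sg_def algebra_simps)
  \<comment> \<open>For odd \<open>q\<close> the separate \<open>k 2\<close> cancels half of the
    \<open>2 * k 2\<close> in \<open>dunkl_coeff\<close>, which leaves one formula for both
    parities.\<close>
  also have "(-1) ^ q * (dunkl_coeff k 2 q + 1 / 2 + of_real (k 3)) + of_real (k 2)
      = (-1) ^ q * (of_nat q + 1 / 2 + of_real (k 2) + of_real (k 3))"
    by (cases "even q") (simp_all add: dunkl_coeff_def)
  finally show ?thesis .
qed

lemma component_Yop:
  assumes "dirac k f = vzero"
  shows "component s (Yop k f (p, q, 0))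
    = (if p = 0 then 0 else \<i> * sg s * (-1) ^ p * dunkl_coeff k 2 (Suc q) * component s (f (p - 1, Suc q, 0)))
      + (-1) ^ p * (of_nat p + 1 / 2 + of_real (k 1) + of_real (k 3)) * component s (f (p, q, 0))"
proof -
  have "component s (Yop k f (p, q, 0)) = (if p = 0 then 0 else
        sg s * (-1) ^ p * (dunkl_coeff k 3 (Suc 0) * component (\<not> s) (f (p - 1, q, Suc 0))))
      + ((-1) ^ p * (1 / 2 + of_real (k 3)) + of_real (k 1)) * component s (f (p, q, 0))"
    by (cases p) (simp_all add: Yop_def BIgen_def Let_def vadd_def vsub_def esig_def mulx_def refl_def
        vscale_def dunkl_apply component_def sg_def sigma_def cpair_add_def cpair_scale_def ex_def incx_def decx_def
        algebra_simps)
  also have "\<dots> = (if p = 0 then 0 else \<i> * sg s * (-1) ^ p * dunkl_coeff k 2 (Suc q) * component s (f (p - 1, Suc q, 0)))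
      + ((-1) ^ p * (dunkl_coeff k 1 p + 1 / 2 + of_real (k 3)) + of_real (k 1)) * component s (f (p, q, 0))"
    unfolding dirac_zero_step[OF assms]
    by (cases p; cases s) (simp_all add: sg_def algebra_simps)
  also have "(-1) ^ p * (dunkl_coeff k 1 p + 1 / 2 + of_real (k 3)) + of_real (k 1)
      = (-1) ^ p * (of_nat p + 1 / 2 + of_real (k 1) + of_real (k 3))"
    by (cases "even p") (simp_all add: dunkl_coeff_def)
  finally show ?thesis .
qed

text \<open>Here \<open>e_3\<close> is diagonal and no \<open>T_3\<close> occurs, so the formula is
  direct.\<close>

lemma component_Zop:
  "component s (Zop k f (p, q, 0)) = (-1) ^ (p + q) * \<i> * sg s *
        ((if q = 0 then 0 else dunkl_coeff k 1 (Suc p) * component s (f (Suc p, q - 1, 0)))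
       - (if p = 0 then 0 else dunkl_coeff k 2 (Suc q) * component s (f (p - 1, Suc q, 0))))
      + ((-1) ^ (p + q) / 2 + (-1) ^ q * of_real (k 1) + (-1) ^ p * of_real (k 2)) * component s (f (p, q, 0))"
  by (cases p; cases q) (simp_all add: Zop_def BIgen_def Let_def vadd_def vsub_def esig_def mulx_def refl_def
        vscale_def dunkl_apply component_def sg_def sigma_def cpair_add_def cpair_scale_def ex_def incx_def decx_def
        power_add algebra_simps)

text \<open>Induction on the exponent of \<open>x_3\<close>: \<open>dirac_zero_step\<close>
  determines the next coefficient after division by a nonzero number.\<close>

lemma Mspace_unique:
  assumes f: "f \<in> Mspace k n" and g: "g \<in> Mspace k n"
    and nz: "\<And>m. m < n \<Longrightarrow> dunkl_coeff k 3 (Suc m) \<noteq> 0"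
    and eq: "\<And>p q. p + q = n \<Longrightarrow> f (p, q, 0) = g (p, q, 0)"
  shows "f = g"
proof -
  have "f (p, q, r) = g (p, q, r)" for p q r
  proof (induction r arbitrary: p q)
    case 0
    then show ?case
      using eq[of p q] f g by (cases "p + q = n") (auto simp: Mspace_def homog_def degm_def)
  next
    case (Suc r)
    show ?case
    proof (cases "p + q + Suc r = n")
      case True
      have "dunkl_coeff k 3 (Suc r) * component s (f (p, q, Suc r)) = dunkl_coeff k 3 (Suc r) * component s (g (p, q, Suc r))" for s
        using dirac_zero_step[of k f r s p q] dirac_zero_step[of k g r s p q] f g Suc.IH
        by (simp add: Mspace_def)
      then show ?thesis using nz[of r] True by (simp add: pair_eq_component)
    next
      case False
      then show ?thesis using f g by (auto simp: Mspace_def homog_def degm_def)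
    qed
  qed
  then show ?thesis by (auto simp: fun_eq_iff)
qed

text \<open>Solves the recursion \<open>dirac_zero_step\<close> with the values \<open>c\<close>
  prescribed on \<open>x_3 = 0\<close>.\<close>

fun extend :: "(nat \<Rightarrow> real) \<Rightarrow> (nat \<Rightarrow> nat \<Rightarrow> bool \<Rightarrow> complex) \<Rightarrow> nat \<Rightarrow> nat \<Rightarrow> nat \<Rightarrow> bool \<Rightarrow> complex" where
  "extend k c p q 0 s = c p q s"
| "extend k c p q (Suc r) s = (- sg s * dunkl_coeff k 1 (Suc p) * extend k c (Suc p) q r (\<not> s)
       + \<i> * dunkl_coeff k 2 (Suc q) * extend k c p (Suc q) r (\<not> s)) / dunkl_coeff k 3 (Suc r)"

lemma Mspace_exists:
  assumes nz: "\<And>m. m < n \<Longrightarrow> dunkl_coeff k 3 (Suc m) \<noteq> 0"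
    and c: "\<And>p q s. p + q \<noteq> n \<Longrightarrow> c p q s = 0"
  obtains f where "f \<in> Mspace k n" "\<And>p q r s. component s (f (p, q, r)) = extend k c p q r s"
proof -
  define f :: vpoly where "f = (\<lambda>(p, q, r). (extend k c p q r True, extend k c p q r False))"
  have component_f: "component s (f (p, q, r)) = extend k c p q r s" for p q r s
    by (cases s) (simp_all add: f_def component_def)
  have zero: "extend k c p q r s = 0" if "p + q + r \<noteq> n" for p q r s
    using that
  proof (induction r arbitrary: p q s)
    case (Suc r)
    then show ?case using Suc.IH[of "Suc p" q] Suc.IH[of p "Suc q"] by simp
  qed (use c in simp)
  have "f a = (0, 0)" if "degm a \<noteq> n" for a
    using that by (cases a) (auto simp: pair_eq_component component_f zero degm_def)
  \<comment> \<open>Only coefficients of total degree \<open>p + q + r + 1\<close> enter, so outside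
    degree \<open>n\<close> every term is zero.\<close>
  moreover have "component s (dirac k f (p, q, r)) = 0" for p q r s
  proof (cases "p + q + Suc r = n")
    case True
    then show ?thesis using nz[of r] by (cases s) (simp_all add: component_dirac component_f sg_def)
  next
    case False
    then show ?thesis
      using zero[of "Suc p" q r] zero[of p "Suc q" r] zero[of p q "Suc r"] by (simp add: component_dirac component_f)
  qed
  then have "dirac k f = vzero"
    by (auto simp: fun_eq_iff vzero_def pair_eq_component)
  ultimately have "f \<in> Mspace k n" by (auto simp: Mspace_def homog_def)
  then show ?thesis using component_f that by blast
qed

text \<open>The recursion in \<open>x_3\<close> uses the exponents \<open>q\<close> and
  \<open>q + 1\<close> of \<open>x_2\<close>. The only step out of the range \<open>q < t\<close> is
  from \<open>t - 1\<close> to \<open>t\<close>, and it carries the factor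
  \<open>dunkl_coeff k 2 t = 0\<close>.\<close>

lemma vanishing_propagates:
  assumes f: "f \<in> Mspace k n"
    and nz: "\<And>m. m < n \<Longrightarrow> dunkl_coeff k 3 (Suc m) \<noteq> 0"
    and t: "dunkl_coeff k 2 t = 0"
    and zero: "\<And>p q. q < t \<Longrightarrow> f (p, q, 0) = (0, 0)"
    and q: "q < t"
  shows "f (p, q, r) = (0, 0)"
  using q
proof (induction r arbitrary: p q)
  case 0
  then show ?case using zero by simp
next
  case (Suc r)
  show ?case
  proof (cases "p + q + Suc r = n")
    case True
    have "dunkl_coeff k 2 (Suc q) * component s (f (p, Suc q, r)) = 0" for s
      using Suc.IH[of "Suc q" p] Suc.prems t by (cases "Suc q = t") auto
    then have "dunkl_coeff k 3 (Suc r) * component s (f (p, q, Suc r)) = 0" for s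
      using dirac_zero_step[of k f r s p q] f Suc.IH[of q "Suc p"] Suc.prems
      by (simp add: Mspace_def mult.assoc)
    then show ?thesis using nz[of r] True by (simp add: pair_eq_component)
  next
    case False
    then show ?thesis using f by (auto simp: Mspace_def homog_def degm_def)
  qed
qed

subsection \<open>Monomial coordinates\<close>

text \<open>
  Coordinates of the restriction to \<open>x\<^sub>3 = 0\<close> with respect to \<open>x\<^sub>1\<^sup>n\<^sup>-\<^sup>j x\<^sub>2\<^sup>j\<close>, \<open>m \<le> j \<le> m + d\<close>.  The scaling makes the
  subdiagonal entries of \<open>X\<close> equal to \<open>(-1)\<^sup>m\<close>.
\<close>

primrec coord_scale :: "(nat \<Rightarrow> real) \<Rightarrow> nat \<Rightarrow> nat \<Rightarrow> bool \<Rightarrow> nat \<Rightarrow> complex" where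
  "coord_scale k n m s 0 = 1"
| "coord_scale k n m s (Suc i) =
     coord_scale k n m s i * (-1) ^ i / (\<i> * sg s * dunkl_coeff k 1 (n - m - i))"

definition coord :: "(nat \<Rightarrow> real) \<Rightarrow> nat \<Rightarrow> nat \<Rightarrow> bool \<Rightarrow> vpoly \<Rightarrow> nat \<Rightarrow> complex" where
  "coord k n m s f i = coord_scale k n m s i * component s (f (n - (m + i), m + i, 0))"

text \<open>Applied with \<open>m = t2\<close>, \<open>d = n - t2\<close> for the submodule and with
  \<open>m = 0\<close>, \<open>d = t2 - 1\<close> for the quotient. The equations for
  \<open>a\<close>, \<open>b\<close>, \<open>\<kappa>\<close> match the diagonals of
  \<open>X\<close>, \<open>Y\<close>, \<open>Z\<close>; \<open>right_end\<close> decouples the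
  window from higher powers of \<open>x_2\<close>.\<close>

locale monomial_window =
  fixes k :: "nat \<Rightarrow> real" and n m d :: nat and a b \<kappa> :: complex and ph :: "nat \<Rightarrow> complex"
  assumes even_n: "even n" and le_n: "m + d \<le> n"
    and coeff1: "\<And>l. 1 \<le> l \<Longrightarrow> l \<le> n \<Longrightarrow> dunkl_coeff k 1 l \<noteq> 0"
    and a_eq: "2 * a - of_nat d = 2 * of_nat m + 1 + 2 * of_real (k 2) + 2 * of_real (k 3)"
    and b_eq: "2 * b - of_nat d = - (2 * (of_nat n - of_nat m) + 1 + 2 * of_real (k 1) + 2 * of_real (k 3))"
    and ph_0: "ph 0 = 0" and ph_end: "ph (Suc d) = 0"
    and ph_eq: "\<And>i. i < d \<Longrightarrow> ph (Suc i) = dunkl_coeff k 1 (n - m - i) * dunkl_coeff k 2 (Suc (m + i))"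
    and kappa_eq: "\<And>i. i \<le> d \<Longrightarrow> \<kappa> - 2 * eigseq d a i * eigseq d b i - ph i - ph (Suc i)
        = 1 / 2 + (-1) ^ (m + i) * (of_real (k 1) + of_real (k 2))"
    and right_end: "m + d = n \<or> dunkl_coeff k 2 (Suc (m + d)) = 0"
begin

lemma scale_nonzero: "i \<le> d \<Longrightarrow> coord_scale k n m s i \<noteq> 0"
proof (induction i)
  case (Suc i)
  then show ?case using coeff1[of "n - m - i"] le_n by (simp add: sg_def)
qed simp

lemma scale_Suc:
  "i < d \<Longrightarrow> \<i> * sg s * dunkl_coeff k 1 (n - m - i) * coord_scale k n m s (Suc i) = coord_scale k n m s i * (-1) ^ i"
  using coeff1[of "n - m - i"] le_n by (simp add: sg_def)

lemma sign_eqs: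
  assumes "i \<le> d"
  shows "(-1) ^ (n - (m + i)) = ((-1) ^ (m + i) :: complex)"
    and "(-1) ^ (n - (m + i) + (m + i)) = (1 :: complex)"
proof -
  have "n = (n - (m + i)) + (m + i)" using assms le_n by simp
  then have "even (n - (m + i) + (m + i))" using even_n by simp
  then show "(-1) ^ (n - (m + i)) = ((-1) ^ (m + i) :: complex)"
    and "(-1) ^ (n - (m + i) + (m + i)) = (1 :: complex)"
    by (auto simp: minus_one_power_iff)
qed

text \<open>Inside the window the scaling absorbs the coefficient of \<open>T_1\<close>; at its left
  edge the neighbour vanishes by \<open>left\<close> or does not exist.\<close>

lemma coord_prev:
  assumes "i \<le> d" and left: "m = 0 \<or> component s (f (n - (m - 1), m - 1, 0)) = 0"
  shows "coord_scale k n m s i * (\<i> * sg s * (if m + i = 0 then 0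
       else dunkl_coeff k 1 (Suc (n - (m + i))) * component s (f (Suc (n - (m + i)), m + i - 1, 0))))
     = (if i = 0 then 0 else - ((-1) ^ i) * coord k n m s f (i - 1))"
proof (cases i)
  case 0
  have "Suc (n - m) = n - (m - 1)" if "m \<noteq> 0" using that le_n by simp
  then show ?thesis using 0 left by auto
next
  case (Suc l)
  have "Suc (n - (m + i)) = n - m - l" "n - m - l = n - (m + l)" using Suc assms(1) le_n by auto
  then show ?thesis using scale_Suc[of l s] assms(1) Suc by (simp add: coord_def mult_ac del: coord_scale.simps)
qed

text \<open>The factor of \<open>T_1\<close> removed from \<open>X\<close> by the scaling reappears
  here, so \<open>ph\<close> is a product of two Dunkl coefficients. At the right edge both sides
  are zero.\<close>

lemma coord_next:
  assumes "i \<le> d"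
  shows "coord_scale k n m s i * (\<i> * sg s * (if n - (m + i) = 0 then 0
       else dunkl_coeff k 2 (Suc (m + i)) * component s (f (n - (m + i) - 1, Suc (m + i), 0))))
     = - ((-1) ^ i) * ph (Suc i) * coord k n m s f (Suc i)"
proof (cases "i = d")
  case True
  then show ?thesis using right_end ph_end by auto
next
  case False
  then have i: "i < d" using assms by simp
  have sc: "coord_scale k n m s i = (-1) ^ i * (\<i> * sg s * dunkl_coeff k 1 (n - m - i) * coord_scale k n m s (Suc i))"
    unfolding scale_Suc[OF i] by (simp add: power_add[symmetric] flip: mult.assoc)
  have "n - (m + i) \<noteq> 0" "n - (m + i) - 1 = n - (m + Suc i)" using i le_n by auto
  moreover have "\<i> * (\<i> * x) = - x" for x
    by (simp flip: mult.assoc)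
  ultimately show ?thesis
    unfolding sc ph_eq[OF i] by (simp add: coord_def sg_def mult_ac del: coord_scale.simps)
qed

context
  fixes f :: vpoly and s :: bool
  assumes f: "dirac k f = vzero" and left: "m = 0 \<or> component s (f (n - (m - 1), m - 1, 0)) = 0"
begin

lemma coord_Xop:
  assumes i: "i \<le> d"
  shows "coord k n m s (Xop k f) i = (-1) ^ m * lower_op (eigseq d a) (coord k n m s f) i"
proof -
  have diag: "(-1) ^ (m + i) * (of_nat (m + i) + 1 / 2 + of_real (k 2) + of_real (k 3)) = (-1) ^ m * eigseq d a i"
    unfolding eigseq_def a_eq by (simp add: power_add field_simps)
  have "coord k n m s (Xop k f) i = - ((-1) ^ (m + i)) *
      (coord_scale k n m s i * (\<i> * sg s * (if m + i = 0 then 0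
       else dunkl_coeff k 1 (Suc (n - (m + i))) * component s (f (Suc (n - (m + i)), m + i - 1, 0)))))
    + ((-1) ^ (m + i) * (of_nat (m + i) + 1 / 2 + of_real (k 2) + of_real (k 3))) * coord k n m s f i"
    unfolding coord_def component_Xop[OF f] by (simp add: algebra_simps)
  also have "\<dots> = (-1) ^ m * lower_op (eigseq d a) (coord k n m s f) i"
    unfolding diag coord_prev[where f = f and s = s, OF i left] by (simp add: lower_op_def power_add algebra_simps)
  finally show ?thesis .
qed

lemma coord_Yop:
  assumes i: "i \<le> d"
  shows "coord k n m s (Yop k f) i = - ((-1) ^ m) * upper_op (eigseq d b) ph (coord k n m s f) i"
proof -
  have diag: "(-1) ^ (m + i) * (of_nat (n - (m + i)) + 1 / 2 + of_real (k 1) + of_real (k 3)) = - ((-1) ^ m) * eigseq d b i"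
    unfolding eigseq_def b_eq using i le_n by (simp add: power_add field_simps of_nat_diff)
  have "coord k n m s (Yop k f) i = (-1) ^ (n - (m + i)) *
      (coord_scale k n m s i * (\<i> * sg s * (if n - (m + i) = 0 then 0
       else dunkl_coeff k 2 (Suc (m + i)) * component s (f (n - (m + i) - 1, Suc (m + i), 0)))))
    + ((-1) ^ (n - (m + i)) * (of_nat (n - (m + i)) + 1 / 2 + of_real (k 1) + of_real (k 3))) * coord k n m s f i"
    unfolding coord_def component_Yop[OF f] by (simp add: algebra_simps)
  also have "\<dots> = - ((-1) ^ m) * upper_op (eigseq d b) ph (coord k n m s f) i"
    unfolding sign_eqs(1)[OF i] diag coord_next[OF i] by (simp add: upper_op_def power_add algebra_simps)
  finally show ?thesis .
qed

text \<open>The off-diagonal entries of \<open>{X,Y}\<close> involve sums of neighbouring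
  eigenvalues, which are signs and match the two shifts in \<open>Z\<close>; the diagonal is
  \<open>kappa_eq\<close>.\<close>

lemma coord_Zop:
  assumes i: "i \<le> d"
  defines "L \<equiv> lower_op (eigseq d a)" and "U \<equiv> upper_op (eigseq d b) ph"
  defines "u \<equiv> coord k n m s f"
  shows "coord k n m s (Zop k f) i = - (L (U u) i + U (L u) i - \<kappa> * u i)"
proof -
  have th: "eigseq d a j + eigseq d a (Suc j) = - ((-1) ^ j)" for j
    by (simp add: eigseq_def field_simps)
  have ps: "eigseq d b j + eigseq d b (Suc j) = - ((-1) ^ j)" for j
    by (simp add: eigseq_def field_simps)
  have "coord k n m s (Zop k f) i =
      (coord_scale k n m s i * (\<i> * sg s * (if m + i = 0 then 0
       else dunkl_coeff k 1 (Suc (n - (m + i))) * component s (f (Suc (n - (m + i)), m + i - 1, 0)))))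
    - (coord_scale k n m s i * (\<i> * sg s * (if n - (m + i) = 0 then 0
       else dunkl_coeff k 2 (Suc (m + i)) * component s (f (n - (m + i) - 1, Suc (m + i), 0)))))
    + (1 / 2 + (-1) ^ (m + i) * (of_real (k 1) + of_real (k 2))) * u i"
    unfolding coord_def u_def component_Zop sign_eqs[OF i] by (simp add: algebra_simps)
  also have "\<dots> = (if i = 0 then 0 else - ((-1) ^ i) * u (i - 1)) + (-1) ^ i * ph (Suc i) * u (Suc i)
    + (\<kappa> - 2 * eigseq d a i * eigseq d b i - ph i - ph (Suc i)) * u i"
    unfolding coord_prev[where f = f and s = s, OF i left] coord_next[OF i] kappa_eq[OF i] u_def by simp
  also have "\<dots> = (if i = 0 then 0 else - (eigseq d b (i - 1) + eigseq d b i) * u (i - 1))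
    - (eigseq d a i + eigseq d a (Suc i)) * ph (Suc i) * u (Suc i)
    + (\<kappa> - 2 * eigseq d a i * eigseq d b i - ph i - ph (Suc i)) * u i"
    unfolding th using ps[of "i - 1"] by (cases i) simp_all
  also have "\<dots> = - (L (U u) i + U (L u) i - \<kappa> * u i)"
    by (cases i) (simp_all add: L_def U_def lower_op_def upper_op_def ph_0 algebra_simps)
  finally show ?thesis .
qed

end

end

section \<open>The matrix module attached to a window\<close>

lemma smult_mat_mult_vec:
  fixes A :: "'a :: comm_ring_1 mat"
  assumes "A \<in> carrier_mat m n" "v \<in> carrier_vec n"
  shows "(c \<cdot>\<^sub>m A) *\<^sub>v v = c \<cdot>\<^sub>v (A *\<^sub>v v)"
  using assms by (intro eq_vecI) auto

lemma anticomm_shift_mult_vec: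
  assumes A: "A \<in> carrier_mat n n" and B: "B \<in> carrier_mat n n" and v: "v \<in> carrier_vec n"
  shows "(anticomm A B - \<kappa> \<cdot>\<^sub>m 1\<^sub>m n) *\<^sub>v v = A *\<^sub>v (B *\<^sub>v v) + B *\<^sub>v (A *\<^sub>v v) - \<kappa> \<cdot>\<^sub>v v"
proof -
  have "(anticomm A B - \<kappa> \<cdot>\<^sub>m 1\<^sub>m n) *\<^sub>v v = anticomm A B *\<^sub>v v - (\<kappa> \<cdot>\<^sub>m 1\<^sub>m n) *\<^sub>v v"
    by (rule minus_mult_distrib_mat_vec[OF anticomm_carrier[OF A B] _ v]) simp
  also have "anticomm A B *\<^sub>v v = (A * B) *\<^sub>v v + (B * A) *\<^sub>v v"
    unfolding anticomm_def by (rule add_mult_distrib_mat_vec[OF _ _ v]) (use A B in auto)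
  also have "(\<kappa> \<cdot>\<^sub>m 1\<^sub>m n) *\<^sub>v v = \<kappa> \<cdot>\<^sub>v v"
    using smult_mat_mult_vec[of "1\<^sub>m n" n n v \<kappa>] v by simp
  finally show ?thesis using A B v by simp
qed

context monomial_window
begin

text \<open>The operators act by \<open>(-1) ^ m\<close>, \<open>- ((-1) ^ m)\<close> and
  \<open>- 1\<close> times the bidiagonal model of \<open>X\<close>, \<open>Y\<close>,
  \<open>Z\<close>, so the parity of \<open>m\<close> selects the twist.\<close>

definition window_rep :: birep where
  "window_rep = (let X = Xmat d a; Y = Ymat d b ph; r = (X, Y, anticomm X Y - \<kappa> \<cdot>\<^sub>m 1\<^sub>m (d + 1))
     in if odd m then twist_m11 r else twist_1m1 r)"

definition half :: "bool \<Rightarrow> vpoly \<Rightarrow> complex vec" where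
  "half s f = vec (d + 1) (coord k n m s f)"

text \<open>On \<open>x_3 = 0\<close> the two components do not mix; they give the two
  summands.\<close>

definition window_map :: "vpoly \<Rightarrow> complex vec" where
  "window_map f = half True f @\<^sub>v half False f"

lemma half_carrier [simp]: "half s f \<in> carrier_vec (d + 1)"
  by (simp add: half_def)

lemma window_rep_carrier:
  "rX window_rep \<in> carrier_mat (d + 1) (d + 1)"
  "rY window_rep \<in> carrier_mat (d + 1) (d + 1)"
  "rZ window_rep \<in> carrier_mat (d + 1) (d + 1)"
  by (auto simp: window_rep_def Let_def twist_m11_def twist_1m1_def Xmat_def Ymat_def)

lemma rdim_window_rep: "rdim window_rep = d + 1"
  using window_rep_carrier(1) by (simp add: rdim_def)

lemma rdim_dsum_window_rep: "rdim (dsum window_rep window_rep) = (d + 1) + (d + 1)"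
  using window_rep_carrier(1) by (simp add: rdim_def dsum_def)

lemma window_map_carrier: "window_map f \<in> carrier_vec (rdim (dsum window_rep window_rep))"
  unfolding rdim_dsum_window_rep window_map_def by (intro append_carrier_vec half_carrier)

lemma half_action:
  assumes f: "dirac k f = vzero" and left: "m = 0 \<or> component s (f (n - (m - 1), m - 1, 0)) = 0"
  shows "half s (Xop k f) = rX window_rep *\<^sub>v half s f"
    and "half s (Yop k f) = rY window_rep *\<^sub>v half s f"
    and "half s (Zop k f) = rZ window_rep *\<^sub>v half s f"
proof -
  let ?u = "coord k n m s f"
  let ?L = "lower_op (eigseq d a)" and ?U = "upper_op (eigseq d b) ph"
  let ?X = "Xmat d a" and ?Y = "Ymat d b ph"
  have Y: "?Y *\<^sub>v vec (d + 1) u = vec (d + 1) (?U u)" for u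
    by (rule Ymat_mult_vec) (simp add: ph_end)
  have "half s (Zop k f) = - vec (d + 1) (\<lambda>i. ?L (?U ?u) i + ?U (?L ?u) i - \<kappa> * ?u i)"
    unfolding half_def by (rule eq_vecI) (simp_all add: coord_Zop[OF f left])
  also have "vec (d + 1) (\<lambda>i. ?L (?U ?u) i + ?U (?L ?u) i - \<kappa> * ?u i)
      = ?X *\<^sub>v (?Y *\<^sub>v half s f) + ?Y *\<^sub>v (?X *\<^sub>v half s f) - \<kappa> \<cdot>\<^sub>v half s f"
    unfolding half_def Y Xmat_mult_vec by (rule eq_vecI) auto
  also have "\<dots> = (anticomm ?X ?Y - \<kappa> \<cdot>\<^sub>m 1\<^sub>m (d + 1)) *\<^sub>v half s f"
    by (rule anticomm_shift_mult_vec[OF Xmat_carrier Ymat_carrier half_carrier, symmetric])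
  also have "- \<dots> = (- (anticomm ?X ?Y - \<kappa> \<cdot>\<^sub>m 1\<^sub>m (d + 1))) *\<^sub>v half s f"
    by (rule uminus_mat_mult_vec[OF _ half_carrier, symmetric]) (auto intro!: minus_carrier_mat)
  finally show "half s (Zop k f) = rZ window_rep *\<^sub>v half s f"
    by (simp add: window_rep_def Let_def twist_m11_def twist_1m1_def)
  have "half s (Xop k f) = (-1) ^ m \<cdot>\<^sub>v (?X *\<^sub>v half s f)"
    unfolding half_def Xmat_mult_vec by (rule eq_vecI) (simp_all add: coord_Xop[OF f left])
  then show "half s (Xop k f) = rX window_rep *\<^sub>v half s f"
    using uminus_mat_mult_vec[OF Xmat_carrier half_carrier, of a s f] Xmat_carrier[of d a]
    by (auto simp: window_rep_def Let_def twist_m11_def twist_1m1_def)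
  have "half s (Yop k f) = - ((-1) ^ m) \<cdot>\<^sub>v (?Y *\<^sub>v half s f)"
    unfolding half_def Y by (rule eq_vecI) (simp_all add: coord_Yop[OF f left])
  then show "half s (Yop k f) = rY window_rep *\<^sub>v half s f"
    using uminus_mat_mult_vec[OF Ymat_carrier half_carrier, of b ph s f] Ymat_carrier[of d b ph]
    by (auto simp: window_rep_def Let_def twist_m11_def twist_1m1_def)
qed

lemma window_map_hom:
  assumes S: "S \<subseteq> Mspace k n" and left: "\<And>f. f \<in> S \<Longrightarrow> m = 0 \<or> f (n - (m - 1), m - 1, 0) = (0, 0)"
  shows "BI_hom_on k S (dsum window_rep window_rep) window_map"
  unfolding BI_hom_on_def
proof (intro conjI ballI allI)
  fix f g :: vpoly and c :: complex
  have "half s (vadd f g) = half s f + half s g" for s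
    unfolding half_def by (rule eq_vecI) (simp_all add: coord_def algebra_simps)
  then show "window_map (vadd f g) = window_map f + window_map g"
    unfolding window_map_def by (simp only: append_vec_add[OF half_carrier half_carrier half_carrier half_carrier])
  have "half s (vscale c f) = c \<cdot>\<^sub>v half s f" for s
    unfolding half_def by (rule eq_vecI) (simp_all add: coord_def algebra_simps)
  then show "window_map (vscale c f) = c \<cdot>\<^sub>v window_map f"
    unfolding window_map_def by (intro eq_vecI) (auto simp: half_def)
next
  fix f assume f: "f \<in> S"
  then have dir: "dirac k f = vzero" using S by (auto simp: Mspace_def)
  have left_s: "m = 0 \<or> component s (f (n - (m - 1), m - 1, 0)) = 0" for s
    using left[OF f] by auto
  have split: "four_block_mat M (0\<^sub>m (rdim window_rep) (rdim window_rep)) (0\<^sub>m (rdim window_rep) (rdim window_rep)) M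
      *\<^sub>v window_map f = M *\<^sub>v half True f @\<^sub>v M *\<^sub>v half False f"
    if "M \<in> carrier_mat (d + 1) (d + 1)" for M
    unfolding window_map_def rdim_window_rep by (rule mult_mat_vec_split[OF that that half_carrier half_carrier])
  note act = half_action[OF dir left_s]
  show "window_map (Xop k f) = rX (dsum window_rep window_rep) *\<^sub>v window_map f"
    "window_map (Yop k f) = rY (dsum window_rep window_rep) *\<^sub>v window_map f"
    "window_map (Zop k f) = rZ (dsum window_rep window_rep) *\<^sub>v window_map f"
    unfolding dsum_def rep_selectors split[OF window_rep_carrier(1)] split[OF window_rep_carrier(2)]
      split[OF window_rep_carrier(3)]
    by (simp_all add: window_map_def act)
qed

lemma window_map_eq_iff:
  "window_map f = window_map g \<longleftrightarrow> (\<forall>j. m \<le> j \<longrightarrow> j \<le> m + d \<longrightarrow> f (n - j, j, 0) = g (n - j, j, 0))"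
proof -
  have "half s f = half s g
      \<longleftrightarrow> (\<forall>i\<le>d. component s (f (n - (m + i), m + i, 0)) = component s (g (n - (m + i), m + i, 0)))" for s
    using scale_nonzero[of _ s]
    by (auto simp: half_def vec_eq_iff coord_def less_Suc_eq_le)
  then have "window_map f = window_map g
      \<longleftrightarrow> (\<forall>i\<le>d. f (n - (m + i), m + i, 0) = g (n - (m + i), m + i, 0))"
    unfolding window_map_def append_vec_eq[OF half_carrier half_carrier]
    by (auto simp: pair_eq_component[of "f _"]) (metis (full_types))+
  also have "\<dots> \<longleftrightarrow> (\<forall>j. m \<le> j \<longrightarrow> j \<le> m + d \<longrightarrow> f (n - j, j, 0) = g (n - j, j, 0))"
  proof -
    have "(\<forall>i\<le>d. Q (m + i)) \<longleftrightarrow> (\<forall>j. m \<le> j \<longrightarrow> j \<le> m + d \<longrightarrow> Q j)" for Q :: "nat \<Rightarrow> bool"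
      by (auto simp: le_iff_add)
    then show ?thesis .
  qed
  finally show ?thesis .
qed

lemma window_map_vzero: "window_map vzero = 0\<^sub>v (rdim (dsum window_rep window_rep))"
  unfolding rdim_dsum_window_rep
  by (rule eq_vecI) (auto simp: window_map_def half_def coord_def vzero_def)

lemma window_map_surj:
  assumes coeff3: "\<And>l. l < n \<Longrightarrow> dunkl_coeff k 3 (Suc l) \<noteq> 0"
    and v: "v \<in> carrier_vec (rdim (dsum window_rep window_rep))"
  obtains f where "f \<in> Mspace k n" "window_map f = v"
    "\<And>p q. q < m \<Longrightarrow> f (p, q, 0) = (0, 0)"
proof -
  \<comment> \<open>Entries of \<open>v\<close> with the scaling undone; the second half of
    \<open>v\<close> goes to the component \<open>False\<close>.\<close>
  define c where "c p q s = (if p + q = n \<and> m \<le> q \<and> q \<le> m + d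
      then v $ (q - m + (if s then 0 else d + 1)) / coord_scale k n m s (q - m) else 0)" for p q s
  obtain f where f: "f \<in> Mspace k n" "\<And>p q r s. component s (f (p, q, r)) = extend k c p q r s"
    by (rule Mspace_exists[OF coeff3, where c = c]) (auto simp: c_def)
  have co: "coord k n m s f i = v $ (i + (if s then 0 else d + 1))" if "i \<le> d" for s i
    using that scale_nonzero[of i s] le_n by (simp add: coord_def f(2) c_def)
  have "window_map f = v"
  proof (rule eq_vecI)
    fix i assume "i < dim_vec v"
    then have "i < (d + 1) + (d + 1)" using v rdim_dsum_window_rep by auto
    then show "window_map f $ i = v $ i"
      using co[of i True] co[of "i - (d + 1)" False] by (auto simp: window_map_def half_def)
  qed (use v window_map_carrier in auto)
  moreover have "f (p, q, 0) = (0, 0)" if "q < m" for p q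
    using that by (simp add: pair_eq_component f(2) c_def)
  ultimately show ?thesis using f(1) that by blast
qed

end

section \<open>Zeros of the Dunkl coefficients\<close>

lemma tval_le_enat:
  assumes "tval x \<le> enat n"
  obtains t where "odd t" "2 * x = - real t" "tval x = enat t"
proof -
  obtain t where t: "odd t" "2 * x = - real t"
    using assms by (auto simp: tval_def split: if_splits)
  moreover have "tval x = enat t" using t by (auto simp: tval_def)
  ultimately show ?thesis by (rule that)
qed

lemma enat_less_tval:
  assumes "enat n < tval x" "odd l" "l \<le> n"
  shows "real l + 2 * x \<noteq> 0"
proof
  assume "real l + 2 * x = 0"
  then have x: "2 * x = - real l" by simp
  then have "tval x = enat l" using \<open>odd l\<close> by (auto simp: tval_def)
  then show False using assms by simp
qed

lemma dunkl_coeff_nonzero: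
  assumes "enat n < tval (k i)" "1 \<le> l" "l \<le> n"
  shows "dunkl_coeff k i l \<noteq> 0"
proof (cases "odd l")
  case True
  have "dunkl_coeff k i l = of_real (real l + 2 * k i)" using True by (simp add: dunkl_coeff_def)
  then show ?thesis using enat_less_tval[OF assms(1) True assms(3)] by (simp only: of_real_eq_0_iff not_False_eq_True)
qed (use assms(2) in \<open>simp add: dunkl_coeff_def\<close>)

text \<open>Membership kills the coefficients left of the window, so the window determines the
  restriction and hence \<open>f\<close>. Conversely, \<open>vanishing_propagates\<close> puts the
  constructed preimages into \<open>Msub\<close>.\<close>

lemma BI_iso_sub_window:
  assumes "monomial_window k n m d a b \<kappa> ph" and n: "m + d = n"
    and t: "tval (k 2) = enat m"
    and coeff2: "dunkl_coeff k 2 m = 0"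
    and coeff3: "\<And>l. l < n \<Longrightarrow> dunkl_coeff k 3 (Suc l) \<noteq> 0"
  shows "BI_iso_sub k (Msub k n 2) (dsum (monomial_window.window_rep m d a b \<kappa> ph)
    (monomial_window.window_rep m d a b \<kappa> ph))"
proof -
  interpret monomial_window k n m d a b \<kappa> ph by fact
  have Msub: "Msub k n 2 \<subseteq> Mspace k n" by (auto simp: Msub_def)
  have zero: "f (p, q, r) = (0, 0)" if "f \<in> Msub k n 2" "q < m" for f p q r
    using that by (auto simp: Msub_def t ex_def)
  have "bij_betw window_map (Msub k n 2) (carrier_vec (rdim (dsum window_rep window_rep)))"
    unfolding bij_betw_def
  proof
    show "inj_on window_map (Msub k n 2)"
    proof (rule inj_onI)
      fix f g assume f: "f \<in> Msub k n 2" and g: "g \<in> Msub k n 2" and eq: "window_map f = window_map g"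
      show "f = g"
      proof (rule Mspace_unique[where k = k and n = n])
        fix p q assume pq: "p + q = n"
        show "f (p, q, 0) = g (p, q, 0)"
        proof (cases "q < m")
          case False
          then have "f (n - q, q, 0) = g (n - q, q, 0)"
            using eq pq n unfolding window_map_eq_iff by auto
          then show ?thesis using pq by auto
        qed (use zero[OF f] zero[OF g] in simp)
      qed (use f g Msub coeff3 in auto)
    qed
    have "v \<in> window_map ` Msub k n 2" if v: "v \<in> carrier_vec (rdim (dsum window_rep window_rep))" for v
    proof -
      obtain f where f: "f \<in> Mspace k n" "window_map f = v" "\<And>p q. q < m \<Longrightarrow> f (p, q, 0) = (0, 0)"
        using window_map_surj[OF coeff3 v] by blast
      have "f (p, q, r) = (0, 0)" if "q < m" for p q r
        by (rule vanishing_propagates[OF f(1) coeff3 coeff2 f(3) that])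
      then have "f \<in> Msub k n 2" using f(1) by (auto simp: Msub_def t ex_def)
      then show ?thesis using f(2) by blast
    qed
    then show "window_map ` Msub k n 2 = carrier_vec (rdim (dsum window_rep window_rep))"
      using window_map_carrier by blast
  qed
  moreover have "BI_hom_on k (Msub k n 2) (dsum window_rep window_rep) window_map"
  proof (rule window_map_hom[OF Msub])
    fix f assume "f \<in> Msub k n 2"
    then show "m = 0 \<or> f (n - (m - 1), m - 1, 0) = (0, 0)" using zero by (cases m) auto
  qed
  ultimately show ?thesis unfolding BI_iso_sub_def by blast
qed

text \<open>The kernel consists of elements whose restriction has no power of \<open>x_2\<close>
  below \<open>t2\<close>; by \<open>vanishing_propagates\<close> this holds off the plane
  too.\<close>

lemma BI_iso_quot_window:
  assumes "monomial_window k n 0 d a b \<kappa> ph"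
    and t: "tval (k 2) = enat (Suc d)"
    and coeff2: "dunkl_coeff k 2 (Suc d) = 0"
    and coeff3: "\<And>l. l < n \<Longrightarrow> dunkl_coeff k 3 (Suc l) \<noteq> 0"
  shows "BI_iso_quot k (Mspace k n) (Msub k n 2) (dsum (monomial_window.window_rep 0 d a b \<kappa> ph)
    (monomial_window.window_rep 0 d a b \<kappa> ph))"
proof -
  interpret monomial_window k n 0 d a b \<kappa> ph by fact
  let ?r = "dsum window_rep window_rep"
  have "window_map f = 0\<^sub>v (rdim ?r) \<longleftrightarrow> f \<in> Msub k n 2" if f: "f \<in> Mspace k n" for f
  proof
    assume "window_map f = 0\<^sub>v (rdim ?r)"
    then have "window_map f = window_map vzero" unfolding window_map_vzero .
    then have zero: "f (n - q, q, 0) = (0, 0)" if "q < Suc d" for q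
      using that unfolding window_map_eq_iff by (auto simp: vzero_def)
    have "f (p, q, 0) = (0, 0)" if "q < Suc d" for p q
      using zero[OF that] f by (cases "p + q = n") (auto simp: Mspace_def homog_def degm_def)
    then have "f (p, q, r) = (0, 0)" if "q < Suc d" for p q r
      using vanishing_propagates[OF f coeff3 coeff2] that by blast
    then show "f \<in> Msub k n 2" using f by (auto simp: Msub_def t ex_def)
  next
    assume "f \<in> Msub k n 2"
    then have "window_map f = window_map vzero"
      unfolding window_map_eq_iff by (auto simp: Msub_def t ex_def vzero_def)
    then show "window_map f = 0\<^sub>v (rdim ?r)" unfolding window_map_vzero .
  qed
  then have "{f \<in> Mspace k n. window_map f = 0\<^sub>v (rdim ?r)} = Msub k n 2"
    by (auto simp: Msub_def)
  moreover have "v \<in> window_map ` Mspace k n" if "v \<in> carrier_vec (rdim ?r)" for v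
    using window_map_surj[OF coeff3 that] by blast
  then have "window_map ` Mspace k n = carrier_vec (rdim ?r)"
    using window_map_carrier by blast
  moreover have "BI_hom_on k (Mspace k n) ?r window_map"
    by (rule window_map_hom) auto
  ultimately show ?thesis unfolding BI_iso_quot_def by blast
qed

section \<open>The two windows and positivity of the parameters\<close>

theorem theorem7p6:
  fixes k :: "nat \<Rightarrow> real" and n :: nat
  assumes "even n"
    and "tval (k 2) \<le> enat n"
    and "enat n < tval (k 1)" and "enat n < tval (k 3)"
  defines "K \<equiv> k 1 + k 2 + k 3"
    and "t2 \<equiv> the_enat (tval (k 2))"
  defines "W1 \<equiv> twist_m11 (Emod (n - t2) (of_real (k 3 + (real n + 1) / 2))
                   (of_real (- K - (real n + 1) / 2)) (of_real (- k 1 - (real n + 1) / 2)))"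
    and "W2 \<equiv> twist_1m1 (Omod (t2 - 1) (of_real (k 3)) (of_real (- K - real n - 1))
                   (of_real (- k 1)))"
  shows "BI_iso_sub k (Msub k n 2) (dsum W1 W1) \<and>
         BI_iso_quot k (Mspace k n) (Msub k n 2) (dsum W2 W2) \<and>
         (k 1 \<ge> 0 \<and> k 3 \<ge> 0 \<longrightarrow>
           rep_irreducible W1 \<and> rep_irreducible W2 \<and>
           rep_iso W1 (twist_m11 (Emod (n - t2) (of_real (k 3 + (real n + 1) / 2))
                   (of_real (K + (real n + 1) / 2)) (of_real (k 1 + (real n + 1) / 2)))) \<and>
           rep_iso W2 (Omod (t2 - 1) (of_real (k 3)) (of_real (K + real n + 1)) (of_real (k 1))))"
proof -
  obtain t where t: "odd t" "2 * k 2 = - real t" "tval (k 2) = enat t"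
    using tval_le_enat[OF assms(2)] .
  have t2: "t2 = t" by (simp add: t2_def t(3))
  have tn: "t \<le> n" using assms(2) t(3) by simp
  have k2: "k 2 = - real t / 2" using t(2) by simp
  define d where "d = n - t"
  define e where "e = t - 1"
  have d: "odd d" "t + d = n" using assms(1) t(1) tn by (simp_all add: d_def)
  have e: "even e" "t = Suc e" using t(1) by (auto simp: e_def elim: oddE)
  have cd: "complex_of_nat n = of_nat t + of_nat d" using d(2) by (metis of_nat_add)
  have ct: "complex_of_nat t = 1 + of_nat e" by (simp add: e(2))
  define a1 b1 c1 where "a1 = complex_of_real (k 3 + (real n + 1) / 2)"
    and "b1 = complex_of_real (- K - (real n + 1) / 2)" and "c1 = complex_of_real (- k 1 - (real n + 1) / 2)"
  define a2 b2 c2 where "a2 = complex_of_real (k 3)" and "b2 = complex_of_real (- K - real n - 1)"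
    and "c2 = complex_of_real (- k 1)"
  note p1 = a1_def b1_def c1_def K_def k2
  note p2 = a2_def b2_def c2_def K_def k2
  let ?k1 = "c1 ^ 2 - a1 ^ 2 - b1 ^ 2 + (of_nat d + 1) ^ 2 / 4" and ?k2 = "2 * a2 * b2 - c2 * (of_nat e + 1)"
  have coeff1: "dunkl_coeff k 1 l \<noteq> 0" if "1 \<le> l" "l \<le> n" for l
    by (rule dunkl_coeff_nonzero[where k = k and i = 1, OF assms(3) that])
  have coeff3: "dunkl_coeff k 3 (Suc l) \<noteq> 0" if "l < n" for l
    by (rule dunkl_coeff_nonzero[where k = k and i = 3, OF assms(4)]) (use that in auto)
  \<comment> \<open>Since \<open>2 * k 2 = - t\<close>, the only positive zero is the odd number
    \<open>l = t\<close>.\<close>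
  have coeff2: "dunkl_coeff k 2 l = (if odd l then of_nat l - of_nat t else of_nat l)" for l
    by (simp add: dunkl_coeff_def k2)
  have coeff2_nz: "dunkl_coeff k 2 l \<noteq> 0" if "l \<noteq> 0" "l \<noteq> t" for l
    using that by (simp add: coeff2)
  have coeff2_t: "dunkl_coeff k 2 t = 0" using t(1) by (simp add: coeff2)
  have win1: "monomial_window k n t d a1 b1 ?k1 (phiE d a1 b1 c1)"
  proof
    fix i assume "i < d"
    then have ci: "complex_of_nat (n - t - i) = of_nat d - of_nat i" by (simp add: of_nat_diff d_def[symmetric])
    have "odd (n - t - i) \<longleftrightarrow> even i" using \<open>i < d\<close> d(1) by (simp add: d_def[symmetric])
    then have c: "dunkl_coeff k 1 (n - t - i) = of_nat d - of_nat i + (if even i then 2 * of_real (k 1) else 0)"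
      unfolding dunkl_coeff_def ci by simp
    show "phiE d a1 b1 c1 (Suc i) = dunkl_coeff k 1 (n - t - i) * dunkl_coeff k 2 (Suc (t + i))"
      unfolding c coeff2 using t(1)
      by (cases "even i") (simp_all add: phiE_def p1 cd field_simps power2_eq_square)
  next
    fix i
    show "?k1 - 2 * eigseq d a1 i * eigseq d b1 i - phiE d a1 b1 c1 i - phiE d a1 b1 c1 (Suc i)
        = 1 / 2 + (-1) ^ (t + i) * (of_real (k 1) + of_real (k 2))"
      using t(1) by (cases "even i")
        (simp_all add: phiE_def eigseq_def p1 cd field_simps power2_eq_square)
  qed (use assms(1) d coeff1 in \<open>simp_all add: phiE_def p1 cd field_simps\<close>)
  have win2: "monomial_window k n 0 e a2 b2 ?k2 (phiO e a2 b2 c2)"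
  proof
    fix i assume "i < e"
    then have ci: "complex_of_nat (n - 0 - i) = of_nat n - of_nat i"
      and "odd (n - 0 - i) \<longleftrightarrow> odd i" using tn e(2) assms(1) by (simp_all add: of_nat_diff)
    then have c: "dunkl_coeff k 1 (n - 0 - i) = of_nat n - of_nat i + (if odd i then 2 * of_real (k 1) else 0)"
      unfolding dunkl_coeff_def ci by simp
    show "phiO e a2 b2 c2 (Suc i) = dunkl_coeff k 1 (n - 0 - i) * dunkl_coeff k 2 (Suc (0 + i))"
      unfolding c coeff2
      by (cases "even i") (simp_all add: phiO_def p2 ct field_simps power2_eq_square)
  next
    fix i
    show "?k2 - 2 * eigseq e a2 i * eigseq e b2 i - phiO e a2 b2 c2 i - phiO e a2 b2 c2 (Suc i)
        = 1 / 2 + (-1) ^ (0 + i) * (of_real (k 1) + of_real (k 2))"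
      by (cases "even i") (simp_all add: phiO_def eigseq_def p2 ct field_simps power2_eq_square)
  qed (use assms(1) e coeff1 tn coeff2_t in \<open>simp_all add: phiO_def p2 ct field_simps\<close>)
  have W1: "W1 = twist_m11 (Emod d a1 b1 c1)"
    by (simp add: W1_def a1_def b1_def c1_def t2 d_def)
  have W2: "W2 = twist_1m1 (Omod e a2 b2 c2)"
    by (simp add: W2_def a2_def b2_def c2_def t2 e_def)
  have rep1: "monomial_window.window_rep t d a1 b1 ?k1 (phiE d a1 b1 c1) = W1"
    unfolding monomial_window.window_rep_def[OF win1] W1 using t(1) by (simp add: Emod_def Let_def)
  have rep2: "monomial_window.window_rep 0 e a2 b2 ?k2 (phiO e a2 b2 c2) = W2"
    unfolding monomial_window.window_rep_def[OF win2] W2 by (simp add: Omod_def Let_def)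
  have sub: "BI_iso_sub k (Msub k n 2) (dsum W1 W1)"
    using BI_iso_sub_window[OF win1 d(2) t(3) coeff2_t coeff3] unfolding rep1 .
  have quot: "BI_iso_quot k (Mspace k n) (Msub k n 2) (dsum W2 W2)"
    using BI_iso_quot_window[OF win2 _ _ coeff3] t(3) coeff2_t unfolding rep2 e(2) by simp
  have "rep_irreducible W1 \<and> rep_irreducible W2 \<and> rep_iso W1 (twist_m11 (Emod d a1 (- b1) (- c1))) \<and>
      rep_iso W2 (Omod e a2 (- b2) (- c2))" if pos: "k 1 \<ge> 0" "k 3 \<ge> 0"
  proof -
    \<comment> \<open>By \<open>ph_eq\<close> the entry is a product of Dunkl coefficients, and the
      index \<open>t + i + 1\<close> is beyond the zero \<open>t\<close>; in \<open>nz2\<close> the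
      index stays below it.\<close>
    have nz1: "phiE d a1 b1 c1 (Suc i) \<noteq> 0" if "i < d" for i
      unfolding monomial_window.ph_eq[OF win1 that] using coeff1[of "n - t - i"] coeff2_nz[of "Suc (t + i)"] that
      by (simp add: d_def)
    have nz2: "phiO e a2 b2 c2 (Suc i) \<noteq> 0" if "i < e" for i
      unfolding monomial_window.ph_eq[OF win2 that] using coeff1[of "n - i"] coeff2_nz[of "Suc i"] that e(2) tn
      by simp
    \<comment> \<open>For the sign-changed parameters the entries no longer come from a window;
      their factors are nonzero by \<open>pos\<close> and the range of \<open>i\<close>.\<close>
    have nz1': "phiE d a1 (- b1) (- c1) (Suc i) \<noteq> 0" if "i < d" for i
    proof (cases "odd i")
      case True
      then have "phiE d a1 (- b1) (- c1) (Suc i) = of_nat (Suc i * (d - i))"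
        unfolding of_nat_mult of_nat_diff[OF less_imp_le[OF that]] by (simp add: phiE_def)
      then show ?thesis using that by (simp only: of_nat_eq_0_iff) simp
    next
      case False
      have "phiE d a1 (- b1) (- c1) (Suc i)
          = of_real (- ((2 * k 3 + real (Suc i)) * (2 * k 1 + 2 * k 3 + real n + 1 + real (Suc i))))"
        using False by (simp add: phiE_def p1 cd field_simps power2_eq_square)
      moreover have "(2 * k 3 + real (Suc i)) * (2 * k 1 + 2 * k 3 + real n + 1 + real (Suc i)) > 0"
        using pos by (intro mult_pos_pos) auto
      ultimately show ?thesis by (metis of_real_eq_0_iff neg_equal_0_iff_equal less_irrefl)
    qed
    have nz2': "phiO e a2 (- b2) (- c2) (Suc i) \<noteq> 0" if "i < e" for i
    proof (cases "odd i")
      case True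
      have "phiO e a2 (- b2) (- c2) (Suc i)
          = of_real (- (real (Suc i) * (2 * k 3 + 2 * k 1 + real n + 1 + real (Suc i) - real t)))"
        using True by (simp add: phiO_def p2 ct e(2) field_simps power2_eq_square)
      moreover have "real (Suc i) * (2 * k 3 + 2 * k 1 + real n + 1 + real (Suc i) - real t) > 0"
        using pos tn by (intro mult_pos_pos) auto
      ultimately show ?thesis by (metis of_real_eq_0_iff neg_equal_0_iff_equal less_irrefl)
    next
      case False
      have "phiO e a2 (- b2) (- c2) (Suc i)
          = of_real ((real t - real (Suc i)) * (2 * k 3 + real n + 1 + real (Suc i) - real t))"
        using False by (simp add: phiO_def p2 ct e(2) field_simps power2_eq_square)
      moreover have "(real t - real (Suc i)) * (2 * k 3 + real n + 1 + real (Suc i) - real t) > 0"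
        using pos tn that e(2) by (intro mult_pos_pos) auto
      ultimately show ?thesis by (metis of_real_eq_0_iff neg_equal_0_iff_equal less_irrefl)
    qed
    \<comment> \<open>As \<open>2 * k 2 = - t\<close>, the number \<open>- 2 * b1\<close> equals
      \<open>2 * k 1 + 2 * k 3 + d + 1\<close>, which exceeds every \<open>i < d\<close>.\<close>
    have sep1: "2 * b1 + of_nat i \<noteq> 0" "- 2 * b1 + of_nat i \<noteq> 0" if "i < d" for i
    proof -
      have "2 * b1 + of_nat i = of_real (- (2 * k 1 + 2 * k 3 + real d + 1 - real i))"
        and "- 2 * b1 + of_nat i = of_real (2 * k 1 + 2 * k 3 + real d + 1 + real i)"
        by (simp_all add: p1 cd field_simps)
      moreover have "2 * k 1 + 2 * k 3 + real d + 1 - real i > 0" "2 * k 1 + 2 * k 3 + real d + 1 + real i > 0"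
        using pos that by auto
      ultimately show "2 * b1 + of_nat i \<noteq> 0" "- 2 * b1 + of_nat i \<noteq> 0"
        by (metis of_real_eq_0_iff neg_equal_0_iff_equal less_irrefl)+
    qed
    have sep2: "2 * b2 + of_nat i \<noteq> 0" "- 2 * b2 + of_nat i \<noteq> 0" if "i < e" for i
    proof -
      have "2 * b2 + of_nat i = of_real (- (2 * k 1 + 2 * k 3 + 2 * real n + 2 - real t - real i))"
        and "- 2 * b2 + of_nat i = of_real (2 * k 1 + 2 * k 3 + 2 * real n + 2 - real t + real i)"
        by (simp_all add: p2 field_simps)
      moreover have "2 * k 1 + 2 * k 3 + 2 * real n + 2 - real t - real i > 0"
          "2 * k 1 + 2 * k 3 + 2 * real n + 2 - real t + real i > 0"
        using pos that tn e(2) by auto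
      ultimately show "2 * b2 + of_nat i \<noteq> 0" "- 2 * b2 + of_nat i \<noteq> 0"
        by (metis of_real_eq_0_iff neg_equal_0_iff_equal less_irrefl)+
    qed
    show ?thesis
      unfolding W1 W2
      using Emod_irreducible[OF d(1) sep1(1) nz1 nz1'] Omod_irreducible[OF e(1) sep2(1) nz2 nz2']
        Emod_iso[OF d(1) sep1(2) nz1 nz1'] Omod_iso[OF e(1) sep2(2) nz2 nz2'] by blast
  qed
  moreover have "- b1 = of_real (K + (real n + 1) / 2)" "- c1 = of_real (k 1 + (real n + 1) / 2)"
    "- b2 = of_real (K + real n + 1)" "- c2 = of_real (k 1)"
    by (simp_all add: b1_def c1_def b2_def c2_def)
  ultimately show ?thesis
    using sub quot unfolding t2 a1_def a2_def d_def e_def by simp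
qed

end
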